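(* Suppose $\Omega\subset\mathbb{P}(\mathbb{R}^d)$ is a quasi-homogeneous properly convex domain. Then there exists $\delta_0=\delta_0(\Omega)>0$ such that: if $m\ge \mathrm{r}_{\rm PES}(\Omega)+1$ and $S$ is a compact $m$-simplex in $\Omega$, then $S$ is $\delta_0$-slim.
   Context: A properly convex domain is a nonempty open set $\Omega\subset\mathbb{P}(\mathbb{R}^d)$ whose closure $\overline{\Omega}$ lies in some affine chart, in which $\Omega$ is a bounded convex set; its dimension is assumed to be at least one. $\partial\Omega=\overline\Omega\setminus\Omega$, $\mathrm{Aut}(\Omega)=\{g\in \mathrm{PGL}_d(\mathbb{R}): g\Omega=\Omega\}$, and $\Omega$ is quasi-homogeneous if there is a compact $K\subset\Omega$ with $\mathrm{Aut}(\Omega)\cdot K=\Omega$. Hilbert metric: for distinct $x,y\in\Omega$ let $x_\infty,y_\infty\in\partial\Omega$ be the endpoints of the intersection of the projective line through $x,y$ with $\overline\Omega$, ordered $x_\infty,x,y,y_\infty$; then $d_\Omega(x,y)=\frac12\log\frac{|y-x_\infty||x-y_\infty|}{|x-x_\infty||y-y_\infty|}$ (and $d_\Omega(x,x)=0$). For nonempty $C\subset\Omega$ and $\delta>0$, $\mathcal{N}_\delta(C)=\{x\in\Omega: d_\Omega(x,C)<\delta\}$, and $\mathcal{N}_0(C)=C$. $\mathrm{CH}_\Omega(X)$ is the convex hull of $X$ in $\overline\Omega$, i.e. the intersection of all convex subsets of $\overline\Omega$ (convex in the affine chart) containing $X$. For $k\ge1$, a $k$-simplex is $S=\mathrm{CH}_\Omega(v_0,\dots,v_k)$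 with an ordered tuple of vertices $v_0,\dots,v_k\in\overline\Omega$ (no general position is required); it is non-degenerate if $\dim\mathbb{P}(\mathrm{Span}\{v_0,\dots,v_k\})=k$. Its facets are $F^i(S)=\mathrm{CH}_\Omega(v_0,\dots,\widehat{v_i},\dots,v_k)$, $0\le i\le k$. It is a compact $k$-simplex in $\Omega$ if all $v_i\in\Omega$. A compact $k$-simplex $S$ is $\delta$-slim if for all $0\le i\le k$, $F^i(S)\subset\bigcup_{j\ne i}\mathcal{N}_\delta(F^j(S))$. A $k$-dimensional PES (properly embedded non-degenerate simplex) in $\Omega$, $k\ge1$, is a non-degenerate $k$-simplex $S$ with vertices in $\partial\Omega$ such that $S\cap\Omega\ne\emptyset$ and $F^i(S)\subset\partial\Omega$ for all $i$. The projective simplex rank is $\mathrm{r}_{\rm PES}(\Omega)=\sup\{\dim S: S\text{ is a PES in }\Omega\}$. *)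

theory Defs
  imports "HOL-Analysis.Analysis"
begin

typedef ('n::finite) proj = "{L :: (real^'n) set. subspace L \<and> dim L = 1}"
  morphisms line_of Abs_proj
proof -
  obtain i :: 'n where True by blast
  have "dim (span {axis i 1 :: real^'n}) = 1"
    by (simp add: dim_eq_card_independent axis_eq_0_iff)
  then show ?thesis
    by (intro exI[of _ "span {axis i 1 :: real^'n}"]) (simp add: subspace_span)
qed

text \<open>Meaningful only for nonzero \<open>v\<close>.\<close>

definition proj_pt :: "real^'n \<Rightarrow> ('n::finite) proj" where
  "proj_pt v = Abs_proj (span {v})"

text \<open>The quotient topology from \<open>\<real>\<^sup>d - {0}\<close>.\<close>

instantiation proj :: (finite) topological_space
begin

definition open_proj :: "'a proj set \<Rightarrow> bool" where
  "open_proj U \<longleftrightarrow> open {v :: real^'a. v \<noteq> 0 \<and> proj_pt v \<in> U}"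

instance
proof
  have "{v :: real^'a. v \<noteq> 0 \<and> proj_pt v \<in> UNIV} = - {0}" by auto
  then show "open (UNIV :: 'a proj set)"
    unfolding open_proj_def by (simp only: open_Compl[OF closed_singleton])
next
  fix S T :: "'a proj set"
  assume "open S" "open T"
  moreover have "{v :: real^'a. v \<noteq> 0 \<and> proj_pt v \<in> S \<inter> T} =
     {v. v \<noteq> 0 \<and> proj_pt v \<in> S} \<inter> {v. v \<noteq> 0 \<and> proj_pt v \<in> T}" by auto
  ultimately show "open (S \<inter> T)"
    unfolding open_proj_def by (simp only: open_Int)
next
  fix K :: "'a proj set set"
  assume "\<forall>S\<in>K. open S"
  moreover have "{v :: real^'a. v \<noteq> 0 \<and> proj_pt v \<in> \<Union>K} =
     (\<Union>S\<in>K. {v. v \<noteq> 0 \<and> proj_pt v \<in> S})" by auto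
  ultimately show "open (\<Union>K)"
    unfolding open_proj_def by (simp only: open_UN)
qed

end

text \<open>\<open>PGL\<^sub>d(\<real>)\<close> acts faithfully on projective space, so it is represented by the group of
  transformations induced by invertible matrices.\<close>

definition proj_action :: "real^'n^'n \<Rightarrow> 'n proj \<Rightarrow> ('n::finite) proj" where
  "proj_action A p = Abs_proj ((*v) A ` line_of p)"

definition PGL :: "('n proj \<Rightarrow> ('n::finite) proj) set" where
  "PGL = {proj_action A | A. invertible A}"

definition Aut :: "('n::finite) proj set \<Rightarrow> ('n proj \<Rightarrow> 'n proj) set" where
  "Aut \<Omega> = {g \<in> PGL. g ` \<Omega> = \<Omega>}"

text \<open>For \<open>a \<noteq> 0\<close>, the affine chart \<open>affine_chart a\<close> is the complement of the projective
  hyperplane of \<open>{v. a \<bullet> v = 0}\<close>; \<open>affine_coord a\<close> identifies it with the affine hyperplane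
  \<open>{v. a \<bullet> v = 1}\<close>.\<close>

definition affine_chart :: "real^'n \<Rightarrow> ('n::finite) proj set" where
  "affine_chart a = {p. \<exists>v\<in>line_of p. a \<bullet> v \<noteq> 0}"

definition affine_coord :: "real^'n \<Rightarrow> ('n::finite) proj \<Rightarrow> real^'n" where
  "affine_coord a p = (THE v. v \<in> line_of p \<and> a \<bullet> v = 1)"

definition convex_chart :: "('n::finite) proj set \<Rightarrow> real^'n \<Rightarrow> bool" where
  "convex_chart \<Omega> a \<longleftrightarrow> a \<noteq> 0 \<and> closure \<Omega> \<subseteq> affine_chart a \<and>
     bounded (affine_coord a ` \<Omega>) \<and> convex (affine_coord a ` \<Omega>)"

definition properly_convex_domain :: "('n::finite) proj set \<Rightarrow> bool" where
  "properly_convex_domain \<Omega> \<longleftrightarrow>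
     CARD('n) \<ge> 2 \<and> \<Omega> \<noteq> {} \<and> open \<Omega> \<and> (\<exists>a. convex_chart \<Omega> a)"

definition bdry :: "('n::finite) proj set \<Rightarrow> 'n proj set" where
  "bdry \<Omega> = closure \<Omega> - \<Omega>"

definition quasi_homogeneous :: "('n::finite) proj set \<Rightarrow> bool" where
  "quasi_homogeneous \<Omega> \<longleftrightarrow> (\<exists>K\<subseteq>\<Omega>. compact K \<and> (\<Union>g\<in>Aut \<Omega>. g ` K) = \<Omega>)"

text \<open>Coordinates in an arbitrarily chosen chart as in the definition of a properly convex
  domain. A transition map between two such charts is a projective map without poles on
  \<open>closure \<Omega>\<close>; it preserves segments in \<open>closure \<Omega>\<close> and cross-ratios, so the notions below do
  not depend on the choice.\<close>

definition coord :: "('n::finite) proj set \<Rightarrow> 'n proj \<Rightarrow> real^'n" where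
  "coord \<Omega> = affine_coord (SOME a. convex_chart \<Omega> a)"

definition proj_line :: "'n proj \<Rightarrow> 'n proj \<Rightarrow> ('n::finite) proj set" where
  "proj_line x y = {p. line_of p \<subseteq> span (line_of x \<union> line_of y)}"

text \<open>\<open>p\<close> and \<open>q\<close> are the points \<open>x\<^sub>\<infinity>\<close> and \<open>y\<^sub>\<infinity>\<close>.\<close>

definition chord_endpoints ::
    "('n::finite) proj set \<Rightarrow> 'n proj \<Rightarrow> 'n proj \<Rightarrow> 'n proj \<Rightarrow> 'n proj \<Rightarrow> bool" where
  "chord_endpoints \<Omega> x y p q \<longleftrightarrow> p \<in> bdry \<Omega> \<and> q \<in> bdry \<Omega> \<and>
     coord \<Omega> ` (proj_line x y \<inter> closure \<Omega>) = closed_segment (coord \<Omega> p) (coord \<Omega> q) \<and>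
     coord \<Omega> x \<in> closed_segment (coord \<Omega> p) (coord \<Omega> y) \<and>
     coord \<Omega> y \<in> closed_segment (coord \<Omega> x) (coord \<Omega> q)"

definition hilbert_dist :: "('n::finite) proj set \<Rightarrow> 'n proj \<Rightarrow> 'n proj \<Rightarrow> real" where
  "hilbert_dist \<Omega> x y = (if x = y then 0 else
     (THE r. \<exists>p q. chord_endpoints \<Omega> x y p q \<and>
        r = 1/2 * ln ((dist (coord \<Omega> y) (coord \<Omega> p) * dist (coord \<Omega> x) (coord \<Omega> q)) /
                      (dist (coord \<Omega> x) (coord \<Omega> p) * dist (coord \<Omega> y) (coord \<Omega> q)))))"

text \<open>Used only for nonempty \<open>C \<subseteq> \<Omega>\<close>, where the infimum is the distance to \<open>C\<close>.\<close>

definition hilbert_nbhd :: "('n::finite) proj set \<Rightarrow> real \<Rightarrow> 'n proj set \<Rightarrow> 'n proj set" where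
  "hilbert_nbhd \<Omega> \<delta> C =
     (if \<delta> = 0 then C else {x \<in> \<Omega>. (INF c\<in>C. hilbert_dist \<Omega> x c) < \<delta>})"

definition CH :: "('n::finite) proj set \<Rightarrow> 'n proj set \<Rightarrow> 'n proj set" where
  "CH \<Omega> X = \<Inter>{C. C \<subseteq> closure \<Omega> \<and> convex (coord \<Omega> ` C) \<and> X \<subseteq> C}"

text \<open>The vertex tuple of a \<open>k\<close>-simplex is the restriction of \<open>v :: nat \<Rightarrow> 'n proj\<close> to \<open>{..k}\<close>;
  values at larger indices are irrelevant.\<close>

definition proj_simplex :: "('n::finite) proj set \<Rightarrow> nat \<Rightarrow> (nat \<Rightarrow> 'n proj) \<Rightarrow> 'n proj set" where
  "proj_simplex \<Omega> k v = CH \<Omega> (v ` {..k})"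

definition facet :: "('n::finite) proj set \<Rightarrow> nat \<Rightarrow> (nat \<Rightarrow> 'n proj) \<Rightarrow> nat \<Rightarrow> 'n proj set" where
  "facet \<Omega> k v i = CH \<Omega> (v ` ({..k} - {i}))"

text \<open>The projectivization of a linear space of dimension \<open>k + 1\<close> has dimension \<open>k\<close>.\<close>

definition nondegenerate :: "nat \<Rightarrow> (nat \<Rightarrow> ('n::finite) proj) \<Rightarrow> bool" where
  "nondegenerate k v \<longleftrightarrow> dim (span (\<Union>i\<le>k. line_of (v i))) = k + 1"

definition compact_simplex :: "('n::finite) proj set \<Rightarrow> nat \<Rightarrow> (nat \<Rightarrow> 'n proj) \<Rightarrow> bool" where
  "compact_simplex \<Omega> k v \<longleftrightarrow> k \<ge> 1 \<and> (\<forall>i\<le>k. v i \<in> \<Omega>)"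

definition slim :: "('n::finite) proj set \<Rightarrow> real \<Rightarrow> nat \<Rightarrow> (nat \<Rightarrow> 'n proj) \<Rightarrow> bool" where
  "slim \<Omega> \<delta> k v \<longleftrightarrow>
     (\<forall>i\<le>k. facet \<Omega> k v i \<subseteq> (\<Union>j\<in>{..k} - {i}. hilbert_nbhd \<Omega> \<delta> (facet \<Omega> k v j)))"

definition PES :: "('n::finite) proj set \<Rightarrow> nat \<Rightarrow> (nat \<Rightarrow> 'n proj) \<Rightarrow> bool" where
  "PES \<Omega> k v \<longleftrightarrow> k \<ge> 1 \<and> nondegenerate k v \<and> (\<forall>i\<le>k. v i \<in> bdry \<Omega>) \<and>
     proj_simplex \<Omega> k v \<inter> \<Omega> \<noteq> {} \<and> (\<forall>i\<le>k. facet \<Omega> k v i \<subseteq> bdry \<Omega>)"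

text \<open>The supremum in \<^typ>\<open>nat\<close> is the true one for a properly convex domain: the set
  contains \<open>1\<close> (the chord through any two points of \<open>\<Omega>\<close>) and is bounded by \<open>d - 1\<close>
  (non-degeneracy).\<close>

definition r_PES :: "('n::finite) proj set \<Rightarrow> nat" where
  "r_PES \<Omega> = Sup {k. \<exists>v. PES \<Omega> k v}"

end

theory Submission
  imports Defs
begin

text \<open>Let \<open>C\<close> be the open convex cone over \<open>\<Omega>\<close> and write \<open>x \<preceq> y\<close> if \<open>y - x \<in> C \<union> {0}\<close>. If
  \<open>x \<preceq> y \<preceq> \<beta> x\<close> in \<open>C\<close>, then the corresponding points of \<open>\<Omega>\<close> have Hilbert distance at most
  \<open>1/2 ln \<beta>\<close>, and this order relation is preserved by linear lifts of automorphisms. If there is no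
  properly embedded simplex of dimension \<open>m\<close>, then every point of a compact \<open>m\<close>-simplex is
  uniformly close to some facet: otherwise, translate points \<open>z\<^sub>n\<close> ever farther from all facets of
  simplices into a compact set; a limit of the simplices has all its facets in the boundary, and
  Caratheodory's argument shows that it is non-degenerate. For a point \<open>x\<close> of a facet, apply this
  to a point far from \<open>x\<close> in the direction of the opposite vertex. Dimensions \<open>m > d + 1\<close> are
  trivial by Caratheodory's theorem, so that finitely many constants remain.\<close>

section \<open>Cones with cocompact automorphism group\<close>

text \<open>The order makes limits and symmetries elementary: since \<open>C\<close> is open, a
  comparison with a limit point in \<open>C\<close> holds with one fixed factor along the sequence,
  and linear maps preserving \<open>C\<close> keep the factor. A single \<beta> suffices because
  \<open>y\<close> may be rescaled along its ray: the two optimal factors comparing \<open>x\<close>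
  and \<open>y\<close> have as product the exponential of twice the Hilbert distance (Birkhoff), and
  this product is at most \<beta>.

  The obstacle is that a point of facet \<open>i\<close> lies on facet \<open>i\<close>, so nearness
  to some facet carries no information about it. Moving the point towards vertex \<open>i\<close> by
  a fixed large amount creates information. If another facet is found, returning to the original
  point costs a fixed factor. If facet \<open>i\<close> is found again, it contains a point
  comparable to the moved one, and this point can be traded against vertex \<open>i\<close> so that
  another generator drops out.\<close>

lemma compact_family_subseq:
  fixes s :: "nat \<Rightarrow> nat \<Rightarrow> 'b::metric_space"
  assumes "compact S" and "\<And>n l. l \<le> m \<Longrightarrow> s n l \<in> S"
  shows "\<exists>r L. strict_mono r \<and> (\<forall>l\<le>m. L l \<in> S \<and> (\<lambda>n. s (r n) l) \<longlonglongrightarrow> L l)"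
  using assms(2)
proof (induction m)
  case 0
  then obtain x r where "x \<in> S" "strict_mono r" "((\<lambda>n. s n 0) \<circ> r) \<longlonglongrightarrow> x"
    using assms(1) unfolding compact_def by (metis le_refl)
  then show ?case by (auto simp: o_def intro!: exI[of _ r] exI[of _ "\<lambda>_. x"])
next
  case (Suc m)
  then obtain r L where r: "strict_mono r"
    and L: "\<forall>l\<le>m. L l \<in> S \<and> (\<lambda>n. s (r n) l) \<longlonglongrightarrow> L l"
    by (metis le_SucI)
  have "\<forall>n. s (r n) (Suc m) \<in> S" using Suc.prems by simp
  then obtain x q where x: "x \<in> S" and q: "strict_mono q"
    and lim: "((\<lambda>n. s (r n) (Suc m)) \<circ> q) \<longlonglongrightarrow> x"
    using assms(1) unfolding compact_def by meson
  have "(\<lambda>n. s (r (q n)) l) \<longlonglongrightarrow> L l" if "l \<le> m" for l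
    using LIMSEQ_subseq_LIMSEQ[of "\<lambda>n. s (r n) l" "L l" q] L that q by (auto simp: o_def)
  then show ?case
    using r q x lim L strict_mono_o[of r q]
    by (intro exI[of _ "r \<circ> q"] exI[of _ "L(Suc m := x)"]) (auto simp: o_def le_Suc_eq)
qed

section \<open>Cones of nonnegative combinations of finite families\<close>

text \<open>Generators are indexed rather than collected in a set: vertices may coincide or be
  dependent, and a facet is obtained by removing an index, not a vector.\<close>

definition cone_span :: "'i set \<Rightarrow> ('i \<Rightarrow> 'a::real_vector) \<Rightarrow> 'a set" where
  "cone_span I v = {\<Sum>l\<in>I. c l *\<^sub>R v l | c. \<forall>l\<in>I. 0 \<le> c l}"

lemma cone_spanI: "(\<And>l. l \<in> I \<Longrightarrow> 0 \<le> c l) \<Longrightarrow> (\<Sum>l\<in>I. c l *\<^sub>R v l) \<in> cone_span I v"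
  unfolding cone_span_def by blast

lemma cone_span_add:
  assumes "x \<in> cone_span I v" "y \<in> cone_span I v" shows "x + y \<in> cone_span I v"
proof -
  obtain c d where "\<And>l. l \<in> I \<Longrightarrow> 0 \<le> c l" "x = (\<Sum>l\<in>I. c l *\<^sub>R v l)"
    "\<And>l. l \<in> I \<Longrightarrow> 0 \<le> d l" "y = (\<Sum>l\<in>I. d l *\<^sub>R v l)"
    using assms unfolding cone_span_def by blast
  then show ?thesis
    using cone_spanI[of I "\<lambda>l. c l + d l" v] by (simp add: scaleR_add_left sum.distrib)
qed

lemma cone_span_scale:
  assumes "x \<in> cone_span I v" "0 \<le> t" shows "t *\<^sub>R x \<in> cone_span I v"
proof -
  obtain c where "\<And>l. l \<in> I \<Longrightarrow> 0 \<le> c l" "x = (\<Sum>l\<in>I. c l *\<^sub>R v l)"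
    using assms unfolding cone_span_def by blast
  then show ?thesis
    using cone_spanI[of I "\<lambda>l. t * c l" v] assms(2) by (simp add: scaleR_sum_right)
qed

lemma cone_span_mono:
  assumes "x \<in> cone_span I v" "I \<subseteq> J" "finite J" shows "x \<in> cone_span J v"
proof -
  obtain c where c: "\<And>l. l \<in> I \<Longrightarrow> 0 \<le> c l" "x = (\<Sum>l\<in>I. c l *\<^sub>R v l)"
    using assms unfolding cone_span_def by blast
  have "(\<Sum>l\<in>J. (if l \<in> I then c l else 0) *\<^sub>R v l) = (\<Sum>l\<in>J. if l \<in> I then c l *\<^sub>R v l else 0)"
    by (rule sum.cong) auto
  also have "\<dots> = x"
    using assms(2,3) c(2) by (simp add: sum.If_cases Int_absorb1)
  finally show ?thesis
    using cone_spanI[of J "\<lambda>l. if l \<in> I then c l else 0" v] c(1) by force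
qed

lemma cone_span_generator:
  assumes "finite I" "l \<in> I" shows "v l \<in> cone_span I v"
proof -
  have "v l \<in> cone_span {l} v" using cone_spanI[of "{l}" "\<lambda>_. 1" v] by simp
  then show ?thesis using cone_span_mono assms by blast
qed

lemma cone_span_linear_image:
  assumes "linear f" "x \<in> cone_span I v" shows "f x \<in> cone_span I (\<lambda>l. f (v l))"
proof -
  obtain c where "\<And>l. l \<in> I \<Longrightarrow> 0 \<le> c l" "x = (\<Sum>l\<in>I. c l *\<^sub>R v l)"
    using assms unfolding cone_span_def by blast
  then show ?thesis
    using cone_spanI[of I c "\<lambda>l. f (v l)"] assms(1) by (simp add: linear_sum linear_scale)
qed

text \<open>Projective vertices are rays, so their representatives may be normalized. This puts the
  translated vertices in \<open>near_facet\<close> into the bounded section.\<close>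

lemma cone_span_rescale:
  assumes "\<And>l. l \<in> I \<Longrightarrow> 0 < t l"
  shows "cone_span I (\<lambda>l. t l *\<^sub>R v l) = cone_span I v"
proof (intro equalityI subsetI)
  fix x assume "x \<in> cone_span I (\<lambda>l. t l *\<^sub>R v l)"
  then obtain c where c: "\<And>l. l \<in> I \<Longrightarrow> 0 \<le> c l" "x = (\<Sum>l\<in>I. c l *\<^sub>R t l *\<^sub>R v l)"
    unfolding cone_span_def by blast
  then show "x \<in> cone_span I v"
    using cone_spanI[of I "\<lambda>l. c l * t l" v] assms by (simp add: less_imp_le)
next
  fix x assume "x \<in> cone_span I v"
  then obtain c where c: "\<And>l. l \<in> I \<Longrightarrow> 0 \<le> c l" "x = (\<Sum>l\<in>I. c l *\<^sub>R v l)"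
    unfolding cone_span_def by blast
  have "x = (\<Sum>l\<in>I. (c l / t l) *\<^sub>R t l *\<^sub>R v l)"
    unfolding c(2) using assms by (intro sum.cong) (auto simp: less_le)
  then show "x \<in> cone_span I (\<lambda>l. t l *\<^sub>R v l)"
    using cone_spanI[of I "\<lambda>l. c l / t l" "\<lambda>l. t l *\<^sub>R v l"] assms c(1) by (simp add: less_imp_le)
qed

text \<open>The largest multiple of \<open>y\<close> that can be split off from \<open>x\<close> exhausts one of the generators.\<close>

lemma cone_span_exhaust:
  assumes fin: "finite I" and x: "x \<in> cone_span I v"
    and y: "y = (\<Sum>l\<in>I. b l *\<^sub>R v l)" and b: "k \<in> I" "0 < b k"
  obtains s j c where "0 \<le> s" "j \<in> I" "c \<in> cone_span (I - {j}) v" "x = s *\<^sub>R y + c"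
proof -
  obtain c where c: "\<And>l. l \<in> I \<Longrightarrow> 0 \<le> c l" "x = (\<Sum>l\<in>I. c l *\<^sub>R v l)"
    using x unfolding cone_span_def by blast
  define J where "J = {l \<in> I. 0 < b l}"
  have J: "finite J" "J \<noteq> {}" using fin b by (auto simp: J_def)
  \<comment> \<open>Ratio test: the smallest quotient is the first at which a coefficient of
    \<open>x - s y\<close> vanishes.\<close>
  define s where "s = Min ((\<lambda>l. c l / b l) ` J)"
  have "s \<in> (\<lambda>l. c l / b l) ` J" unfolding s_def using J by simp
  then obtain j where j: "j \<in> J" "s = c j / b j" by blast
  have s0: "0 \<le> s" using j c(1) by (auto simp: J_def)
  have nonneg: "0 \<le> c l - s * b l" if "l \<in> I" for l
  proof (cases "0 < b l")
    case True
    then have "s \<le> c l / b l" unfolding s_def using J that by (simp add: J_def)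
    then show ?thesis using True by (simp add: pos_le_divide_eq)
  next
    \<comment> \<open>The remaining coefficients of \<open>y\<close> may be negative. Linear
      independence of embedded simplices relies on this, with \<open>y = 0\<close>.\<close>
    case False
    then show ?thesis using s0 c(1)[OF that] by (smt (verit) mult_nonneg_nonpos)
  qed
  have "j \<in> I" and zero: "c j - s * b j = 0" using j by (auto simp: J_def)
  have "x - s *\<^sub>R y = (\<Sum>l\<in>I. (c l - s * b l) *\<^sub>R v l)"
    unfolding c(2) y by (simp add: scaleR_sum_right sum_subtractf scaleR_diff_left)
  also have "\<dots> = (\<Sum>l\<in>I - {j}. (c l - s * b l) *\<^sub>R v l)"
    using fin \<open>j \<in> I\<close> zero by (simp add: sum.remove)
  finally have "x - s *\<^sub>R y \<in> cone_span (I - {j}) v"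
    using cone_spanI[of "I - {j}" "\<lambda>l. c l - s * b l" v] nonneg by simp
  then show ?thesis using that[of s j "x - s *\<^sub>R y"] s0 \<open>j \<in> I\<close> by simp
qed

lemma cone_span_convex_hull:
  assumes "finite I" "x \<in> convex hull (w ` I)" shows "x \<in> cone_span I w"
proof -
  have "convex (cone_span I w)"
    by (intro convexI cone_span_add cone_span_scale)
  moreover have "w ` I \<subseteq> cone_span I w" by (intro image_subsetI cone_span_generator assms(1))
  ultimately show ?thesis using hull_minimal[of "w ` I" "cone_span I w" convex] assms(2) by auto
qed

text \<open>The generators lie on the hyperplane where \<open>a\<close> equals 1, so the total
  weight of a combination is its value under \<open>a\<close>; dividing by it gives convex
  coefficients.\<close>

lemma convex_hull_cone_span:
  assumes "finite I" "\<And>l. l \<in> I \<Longrightarrow> a \<bullet> w l = 1" "x \<in> cone_span I w" "0 < a \<bullet> x"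
  shows "(1 / (a \<bullet> x)) *\<^sub>R x \<in> convex hull (w ` I)"
proof -
  obtain c where c: "\<And>l. l \<in> I \<Longrightarrow> 0 \<le> c l" "x = (\<Sum>l\<in>I. c l *\<^sub>R w l)"
    using assms(3) unfolding cone_span_def by blast
  have s: "a \<bullet> x = sum c I" unfolding c(2) inner_sum_right using assms(2) by simp
  have "(\<Sum>l\<in>I. (c l / (a \<bullet> x)) *\<^sub>R w l) \<in> convex hull (w ` I)"
    using assms(1,4) c(1) s
    by (intro convex_sum) (auto simp: hull_inc sum_divide_distrib[symmetric])
  moreover have "(\<Sum>l\<in>I. (c l / (a \<bullet> x)) *\<^sub>R w l) = (1 / (a \<bullet> x)) *\<^sub>R x"
    by (subst (2) c(2)) (simp add: scaleR_sum_right)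
  ultimately show ?thesis by simp
qed

text \<open>Caratheodory's theorem yields few points, not few indices. Selecting one index for each
  point leaves an index free, even if \<open>w\<close> is not injective.\<close>

lemma convex_hull_drop_vertex:
  fixes w :: "'i \<Rightarrow> 'a::euclidean_space"
  assumes "finite I" "card I > DIM('a) + 1" "x \<in> convex hull (w ` I)"
  obtains j where "j \<in> I" "x \<in> convex hull (w ` (I - {j}))"
proof -
  obtain S where S: "finite S" "S \<subseteq> w ` I" "card S \<le> DIM('a) + 1" "x \<in> convex hull S"
    using assms(3) unfolding caratheodory[of "w ` I"] by blast
  obtain J where J: "J \<subseteq> I" "inj_on w J" "S = w ` J"
    using S(2) unfolding subset_image_inj by blast
  have "card J < card I" using card_image[OF J(2)] J(3) assms(2) S(3) by simp
  then have "\<not> I \<subseteq> J" using card_mono[of J I] finite_subset[OF J(1) assms(1)] by linarith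
  then obtain j where j: "j \<in> I" "j \<notin> J" by blast
  then have "S \<subseteq> w ` (I - {j})" using J by blast
  then show ?thesis using that[OF j(1)] S(4) hull_mono[of S _ convex] by blast
qed

section \<open>The order defined by a cone with cocompact symmetries\<close>

text \<open>Cocompactness is stated for vectors, not rays: \<open>g\<close> absorbs the rescaling of
  \<open>x\<close>, so that \<open>K\<close> is an honest compact subset of the open cone.\<close>

locale cocompact_cone =
  fixes C :: "'a::euclidean_space set" and a :: 'a and K :: "'a set"
  assumes open_C: "open C"
    and add_C: "\<And>x y. x \<in> C \<Longrightarrow> y \<in> C \<Longrightarrow> x + y \<in> C"
    and scale_C: "\<And>x t. x \<in> C \<Longrightarrow> 0 < t \<Longrightarrow> t *\<^sub>R x \<in> C"
    and pos_C: "\<And>x. x \<in> C \<Longrightarrow> 0 < a \<bullet> x"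
    and bounded_section: "bounded {x \<in> C. a \<bullet> x = 1}"
    and compact_K: "compact K" and K_sub: "K \<subseteq> C"
    and cocompact: "\<And>x. x \<in> C \<Longrightarrow>
      \<exists>f g. linear f \<and> linear g \<and> (\<forall>v. f (g v) = v) \<and> f ` C \<subseteq> C \<and> g ` C \<subseteq> C \<and> g x \<in> K"
begin

definition B :: "'a set" where "B = {x \<in> C. a \<bullet> x = 1}"

definition le :: "'a \<Rightarrow> 'a \<Rightarrow> bool"  (infix "\<preceq>" 50) where
  "x \<preceq> y \<longleftrightarrow> y - x \<in> insert 0 C"

text \<open>The linear counterpart of \<open>PES\<close>; linear independence of the \<open>w l\<close> follows.\<close>

definition embedded_simplex_cone :: "nat \<Rightarrow> (nat \<Rightarrow> 'a) \<Rightarrow> bool" where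
  "embedded_simplex_cone m w \<longleftrightarrow> (\<forall>l\<le>m. w l \<in> closure B) \<and> cone_span {..m} w \<inter> C \<noteq> {} \<and>
     (\<forall>j\<le>m. cone_span ({..m} - {j}) w \<inter> C = {})"

lemma le_refl: "x \<preceq> x" by (simp add: le_def)

lemma le_trans: "x \<preceq> y \<Longrightarrow> y \<preceq> z \<Longrightarrow> x \<preceq> z"
  using add_C[of "y - x" "z - y"] by (auto simp: le_def)

lemma le_add: "x \<preceq> y \<Longrightarrow> u \<preceq> w \<Longrightarrow> x + u \<preceq> y + w"
  using add_C[of "y - x" "w - u"] by (auto simp: le_def algebra_simps)

lemma le_scale: "x \<preceq> y \<Longrightarrow> 0 \<le> t \<Longrightarrow> t *\<^sub>R x \<preceq> t *\<^sub>R y"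
  using scale_C[of "y - x" t] by (cases "t = 0") (auto simp: le_def scaleR_diff_right[symmetric])

lemma le_linear: "linear f \<Longrightarrow> f ` C \<subseteq> C \<Longrightarrow> x \<preceq> y \<Longrightarrow> f x \<preceq> f y"
  by (auto simp: le_def linear_diff[symmetric] linear_0)

lemma le_inner: "x \<preceq> y \<Longrightarrow> a \<bullet> x \<le> a \<bullet> y"
  using pos_C[of "y - x"] by (auto simp: le_def inner_diff_right)

lemma C_le: "x \<in> C \<Longrightarrow> 0 \<preceq> x" by (simp add: le_def)

lemma in_C_le: "x \<in> C \<Longrightarrow> x \<preceq> y \<Longrightarrow> y \<in> C"
  using add_C[of x "y - x"] by (auto simp: le_def)

lemma le_scale_left: "0 \<preceq> x \<Longrightarrow> s \<le> t \<Longrightarrow> s *\<^sub>R x \<preceq> t *\<^sub>R x"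
  using scale_C[of x "t - s"]
  by (cases "s = t") (auto simp: le_def scaleR_diff_left[symmetric])

lemma not_zero_C: "0 \<notin> C" using pos_C[of 0] by auto

lemma cone_span_ge_0:
  assumes "finite I" "\<And>l. l \<in> I \<Longrightarrow> v l \<in> C" "x \<in> cone_span I v" shows "0 \<preceq> x"
proof -
  obtain c where c: "\<And>l. l \<in> I \<Longrightarrow> 0 \<le> c l" "x = (\<Sum>l\<in>I. c l *\<^sub>R v l)"
    using assms unfolding cone_span_def by blast
  have "0 \<preceq> (\<Sum>l\<in>I. c l *\<^sub>R v l)" using assms(1,2) c(1)
  proof (induction I rule: finite_induct)
    case empty then show ?case by (simp add: le_refl)
  next
    case (insert k F)
    have "0 \<preceq> c k *\<^sub>R v k" using le_scale[OF C_le[of "v k"], of "c k"] insert.prems by simp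
    then show ?case using insert le_add[of 0 "c k *\<^sub>R v k" 0 "\<Sum>l\<in>F. c l *\<^sub>R v l"] by simp
  qed
  then show ?thesis using c(2) by simp
qed

text \<open>As \<open>C\<close> is open, \<open>x - s z\<close> lies in \<open>C\<close> for some
  small \<open>s > 0\<close>, and then so does \<open>X n - s Z n\<close> for large
  \<open>n\<close>. Hence \<open>t = 1 / s\<close> is uniform in \<open>n\<close>. The limit
  \<open>z\<close> is arbitrary; only \<open>x\<close> has to be interior.\<close>

lemma eventually_le:
  assumes "x \<in> C" "(X \<longlongrightarrow> x) sequentially" "(Z \<longlongrightarrow> z) sequentially"
  shows "\<exists>t>0. \<forall>\<^sub>F n in sequentially. Z n \<preceq> t *\<^sub>R X n"
proof -
  have "((\<lambda>s. x - s *\<^sub>R z) \<longlongrightarrow> x - 0 *\<^sub>R z) (at_right 0)"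
    by (intro tendsto_intros)
  then have "\<forall>\<^sub>F s in at_right 0. x - s *\<^sub>R z \<in> C"
    using topological_tendstoD[OF _ open_C, of "\<lambda>s. x - s *\<^sub>R z" x "at_right 0"] assms(1) by simp
  then have "\<forall>\<^sub>F s in at_right (0::real). x - s *\<^sub>R z \<in> C \<and> s > 0"
    by (intro eventually_conj eventually_at_right_less)
  then obtain s where s: "x - s *\<^sub>R z \<in> C" "s > 0"
    using eventually_happens[of _ "at_right (0::real)"] by fastforce
  have "((\<lambda>n. X n - s *\<^sub>R Z n) \<longlongrightarrow> x - s *\<^sub>R z) sequentially"
    by (intro tendsto_intros assms)
  then have "\<forall>\<^sub>F n in sequentially. X n - s *\<^sub>R Z n \<in> C"
    using topological_tendstoD[OF _ open_C] s(1) by blast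
  then have "\<forall>\<^sub>F n in sequentially. Z n \<preceq> (1 / s) *\<^sub>R X n"
  proof (rule eventually_mono)
    fix n assume "X n - s *\<^sub>R Z n \<in> C"
    then have "(1 / s) *\<^sub>R (X n - s *\<^sub>R Z n) \<in> C" using scale_C s(2) by simp
    then show "Z n \<preceq> (1 / s) *\<^sub>R X n" using s(2) by (simp add: le_def algebra_simps)
  qed
  then show ?thesis using s(2) by (intro exI[of _ "1 / s"]) simp
qed

lemma compact_closure_B: "compact (closure B)"
  using bounded_section by (simp add: compact_closure B_def)

lemma closure_B_inner: "x \<in> closure B \<Longrightarrow> a \<bullet> x = 1"
proof -
  have "closure B \<subseteq> {x. a \<bullet> x = 1}"
    by (rule closure_minimal) (auto simp: B_def closed_hyperplane)
  then show "x \<in> closure B \<Longrightarrow> a \<bullet> x = 1" by auto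
qed

lemma normalize_B: "x \<in> C \<Longrightarrow> (1 / (a \<bullet> x)) *\<^sub>R x \<in> B"
  using pos_C[of x] scale_C[of x "1 / (a \<bullet> x)"] by (simp add: B_def)

section \<open>Limits of simplices containing points far from all facets\<close>

text \<open>Vertices and coefficients stay in compact sets, so the points \<open>z n\<close>
  subconverge together with their representations, to a point of \<open>K\<close>. If a facet of the
  limit met \<open>C\<close>, nearby points of the approximating facets would be comparable to
  \<open>z n\<close> with a fixed factor, against \<open>far\<close>. The limit vertices may leave
  \<open>B\<close> but not its closure.\<close>

lemma embedded_simplex_limit:
  assumes v: "\<And>n l. l \<le> m \<Longrightarrow> v n l \<in> B"
    and z: "\<And>n. z n \<in> cone_span {..m} (v n)" "\<And>n. z n \<in> K"
    and far: "\<And>n j y. j \<le> m \<Longrightarrow> y \<in> cone_span ({..m} - {j}) (v n) \<Longrightarrow>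
      z n \<preceq> y \<Longrightarrow> \<not> y \<preceq> real n *\<^sub>R z n"
  shows "\<exists>w. embedded_simplex_cone m w"
proof -
  have "\<forall>n. \<exists>c. (\<forall>l\<in>{..m}. 0 \<le> c l) \<and> z n = (\<Sum>l\<le>m. c l *\<^sub>R v n l)"
    using z(1) unfolding cone_span_def by blast
  then obtain c where c: "\<And>n l. l \<le> m \<Longrightarrow> 0 \<le> c n l" "\<And>n. z n = (\<Sum>l\<le>m. c n l *\<^sub>R v n l)"
    by (metis atMost_iff)
  obtain M where M: "\<And>x. x \<in> K \<Longrightarrow> norm x \<le> M"
    using compact_imp_bounded[OF compact_K] by (auto simp: bounded_iff)
  \<comment> \<open>The functional \<open>a\<close> equals 1 on the vertices, so the nonnegative
    coefficients of \<open>z n\<close> sum to \<open>a \<bullet> z n\<close>, which is bounded on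
    \<open>K\<close>.\<close>
  have "c n l \<le> norm a * M" if "l \<le> m" for n l
  proof -
    have "c n l \<le> (\<Sum>l\<le>m. c n l)"
      using that c(1) by (intro member_le_sum) auto
    also have "\<dots> = a \<bullet> z n"
      using v unfolding c(2) inner_sum_right by (intro sum.cong) (auto simp: B_def)
    also have "\<dots> \<le> norm a * norm (z n)" by (rule norm_cauchy_schwarz)
    also have "\<dots> \<le> norm a * M" using M z(2) by (intro mult_left_mono) auto
    finally show ?thesis .
  qed
  then have "(v n l, c n l) \<in> closure B \<times> {0..norm a * M}" if "l \<le> m" for n l
    using v c(1) closure_subset that by (auto simp del: mem_Times_iff) blast+
  moreover have "compact (closure B \<times> {0..norm a * M})"
    by (intro compact_Times compact_closure_B compact_Icc)
  ultimately obtain r L where r: "strict_mono r"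
    and L: "\<And>l. l \<le> m \<Longrightarrow> L l \<in> closure B \<times> {0..norm a * M} \<and>
       (\<lambda>n. (v (r n) l, c (r n) l)) \<longlonglongrightarrow> L l"
    using compact_family_subseq[of "closure B \<times> {0..norm a * M}" m "\<lambda>n l. (v n l, c n l)"] by blast
  define w d where "w = fst \<circ> L" and "d = snd \<circ> L"
  have w: "w l \<in> closure B" "(\<lambda>n. v (r n) l) \<longlonglongrightarrow> w l"
    and d: "0 \<le> d l" "(\<lambda>n. c (r n) l) \<longlonglongrightarrow> d l" if "l \<le> m" for l
    using L[OF that] tendsto_fst[of _ "L l" sequentially] tendsto_snd[of _ "L l" sequentially]
    by (fastforce simp: w_def d_def mem_Times_iff)+
  define x where "x = (\<Sum>l\<le>m. d l *\<^sub>R w l)"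
  have lim: "(\<lambda>n. z (r n)) \<longlonglongrightarrow> x"
    unfolding c(2) x_def by (intro tendsto_intros w(2) d(2)) auto
  have "x \<in> K"
    using closed_sequentially[OF compact_imp_closed[OF compact_K] _ lim] z(2) by blast
  then have xC: "x \<in> C" using K_sub by auto
  have "x \<in> cone_span {..m} w" unfolding x_def using d(1) by (intro cone_spanI) auto
  moreover have "y \<notin> C" if j: "j \<le> m" and y: "y \<in> cone_span ({..m} - {j}) w" for j y
  proof
    assume "y \<in> C"
    obtain b where b: "\<And>l. l \<in> {..m} - {j} \<Longrightarrow> 0 \<le> b l" "y = (\<Sum>l\<in>{..m} - {j}. b l *\<^sub>R w l)"
      using y unfolding cone_span_def by blast
    \<comment> \<open>The coefficients of \<open>y\<close> are kept and the limit vertices replaced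
      by the approximating ones, which gives a point of the same facet.\<close>
    define Y where "Y n = (\<Sum>l\<in>{..m} - {j}. b l *\<^sub>R v (r n) l)" for n
    have Y: "Y \<longlonglongrightarrow> y"
      unfolding Y_def b(2) by (intro tendsto_intros w(2)) auto
    obtain t where t: "t > 0" "\<forall>\<^sub>F n in sequentially. z (r n) \<preceq> t *\<^sub>R Y n"
      using eventually_le[OF \<open>y \<in> C\<close> Y lim] by blast
    obtain u where u: "u > 0" "\<forall>\<^sub>F n in sequentially. Y n \<preceq> u *\<^sub>R z (r n)"
      using eventually_le[OF xC lim Y] by blast
    \<comment> \<open>The point \<open>t Y n\<close> dominates \<open>z (r n)\<close> and is at most
      \<open>t u\<close> times it. This contradicts \<open>far\<close> once \<open>r n\<close>
      exceeds \<open>t u\<close>, which happens because \<open>r n \<ge> n\<close>.\<close>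
    obtain N :: nat where N: "t * u \<le> real N" using real_arch_simple by blast
    have "\<forall>\<^sub>F n in sequentially. z (r n) \<preceq> t *\<^sub>R Y n \<and> Y n \<preceq> u *\<^sub>R z (r n) \<and> N \<le> n"
      using t(2) u(2) eventually_ge_at_top by (intro eventually_conj) auto
    then obtain n where n: "z (r n) \<preceq> t *\<^sub>R Y n" "Y n \<preceq> u *\<^sub>R z (r n)" "N \<le> n"
      using eventually_happens'[OF sequentially_bot] by blast
    have "t *\<^sub>R Y n \<in> cone_span ({..m} - {j}) (v (r n))"
      unfolding Y_def using t(1) b(1) by (intro cone_span_scale cone_spanI) auto
    moreover have "t *\<^sub>R Y n \<preceq> real (r n) *\<^sub>R z (r n)"
    proof (rule le_trans)
      show "t *\<^sub>R Y n \<preceq> (t * u) *\<^sub>R z (r n)"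
        using le_scale[OF n(2), of t] t(1) by simp
      have "t * u \<le> real (r n)"
        using N n(3) seq_suble[OF r, of n] by linarith
      then show "(t * u) *\<^sub>R z (r n) \<preceq> real (r n) *\<^sub>R z (r n)"
        using z(2) K_sub by (intro le_scale_left C_le) auto
    qed
    ultimately show False using far[OF j] n(1) by blast
  qed
  ultimately show ?thesis
    unfolding embedded_simplex_cone_def using w(1) xC by blast
qed

lemma near_facet:
  assumes "\<nexists>w. embedded_simplex_cone m w"
  shows "\<exists>D\<ge>1. \<forall>v z. (\<forall>l\<le>m. v l \<in> C) \<longrightarrow> z \<in> cone_span {..m} v \<longrightarrow> z \<in> C \<longrightarrow>
    (\<exists>j\<le>m. \<exists>y\<in>cone_span ({..m} - {j}) v. z \<preceq> y \<and> y \<preceq> D *\<^sub>R z)"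
proof (rule ccontr)
  assume neg: "\<not> ?thesis"
  have "\<exists>v z. (\<forall>l\<le>m. v l \<in> B) \<and> z \<in> cone_span {..m} v \<and> z \<in> K \<and>
    (\<forall>j y. j \<le> m \<longrightarrow> y \<in> cone_span ({..m} - {j}) v \<longrightarrow> z \<preceq> y \<longrightarrow> \<not> y \<preceq> real n *\<^sub>R z)" for n
  proof -
    \<comment> \<open>The constant to be refuted must be at least 1, also for \<open>n = 0\<close>;
      hence the shift, undone below by weakening.\<close>
    have "1 \<le> real n + 1" by simp
    then obtain v z where v: "\<forall>l\<le>m. v l \<in> C" and z: "z \<in> cone_span {..m} v" "z \<in> C"
      and far: "\<forall>j\<le>m. \<forall>y\<in>cone_span ({..m} - {j}) v. z \<preceq> y \<longrightarrow> \<not> y \<preceq> (real n + 1) *\<^sub>R z"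
      using neg by blast
    obtain f g where fg: "linear f" "linear g" "\<And>v. f (g v) = v" "f ` C \<subseteq> C" "g ` C \<subseteq> C" "g z \<in> K"
      using cocompact[OF z(2)] by blast
    define s where "s l = 1 / (a \<bullet> g (v l))" for l
    have gv: "g (v l) \<in> C" if "l \<le> m" for l using v fg(5) that by blast
    have s: "0 < s l" if "l \<le> m" for l using pos_C[OF gv[OF that]] by (simp add: s_def)
    have span: "cone_span I (\<lambda>l. s l *\<^sub>R g (v l)) = cone_span I (\<lambda>l. g (v l))" if "I \<subseteq> {..m}" for I
      using s that by (intro cone_span_rescale) auto
    \<comment> \<open>A facet point close to \<open>g z\<close> would be carried back by
      \<open>f\<close> to a point of the original facet equally close to \<open>z\<close>.\<close>
    have "\<not> y \<preceq> real n *\<^sub>R g z"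
      if "j \<le> m" "y \<in> cone_span ({..m} - {j}) (\<lambda>l. g (v l))" "g z \<preceq> y" for j y
    proof
      assume "y \<preceq> real n *\<^sub>R g z"
      then have "f y \<preceq> real n *\<^sub>R z"
        using le_linear[OF fg(1,4)] fg(1,3) by (metis linear_scale)
      also have "real n *\<^sub>R z \<preceq> (real n + 1) *\<^sub>R z"
        using z(2) by (intro le_scale_left C_le) auto
      finally (le_trans) have "f y \<preceq> (real n + 1) *\<^sub>R z" .
      moreover have "f y \<in> cone_span ({..m} - {j}) v"
        using cone_span_linear_image[OF fg(1) that(2)] fg(3) by simp
      moreover have "z \<preceq> f y" using le_linear[OF fg(1,4) that(3)] fg(3) by simp
      ultimately show False using far that(1) by blast
    qed
    then show ?thesis
      using normalize_B[OF gv] cone_span_linear_image[OF fg(2) z(1)] fg(6) span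
      by (intro exI[of _ "\<lambda>l. s l *\<^sub>R g (v l)"] exI[of _ "g z"]) (auto simp: s_def)
  qed
  then obtain v z where "\<And>n. (\<forall>l\<le>m. v n l \<in> B) \<and> z n \<in> cone_span {..m} (v n) \<and> z n \<in> K \<and>
    (\<forall>j y. j \<le> m \<longrightarrow> y \<in> cone_span ({..m} - {j}) (v n) \<longrightarrow> z n \<preceq> y \<longrightarrow> \<not> y \<preceq> real n *\<^sub>R z n)"
    by metis
  then show False using embedded_simplex_limit[of m v z] assms by blast
qed

section \<open>From nearness to some facet to nearness to another facet\<close>

text \<open>Balls of one radius \<open>e\<close> around the points of \<open>K\<close> lie in
  \<open>C\<close>, and \<open>B\<close> is bounded by some \<open>M\<close>. So
  \<open>x - v / \<kappa>\<close> remains in \<open>C\<close> as soon as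
  \<open>M / \<kappa> < e\<close>. This bounds what moving towards a vertex adds to a point of
  \<open>K\<close>.\<close>

lemma section_le_K: "\<exists>\<kappa>>0. \<forall>x\<in>K. \<forall>v\<in>B. v \<preceq> \<kappa> *\<^sub>R x"
proof -
  obtain e where e: "0 < e" "(\<Union>x\<in>K. ball x e) \<subseteq> C"
    using compact_subset_open_imp_ball_epsilon_subset[OF compact_K open_C K_sub] by blast
  obtain M where M: "0 < M" "\<And>v. v \<in> B \<Longrightarrow> norm v \<le> M"
    using bounded_section by (auto simp: bounded_pos B_def)
  define \<kappa> where "\<kappa> = 2 * M / e"
  have k: "0 < \<kappa>" using e M by (simp add: \<kappa>_def)
  have "v \<preceq> \<kappa> *\<^sub>R x" if "x \<in> K" "v \<in> B" for x v
  proof -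
    have "norm ((1 / \<kappa>) *\<^sub>R v) \<le> (1 / \<kappa>) * M"
      using M(2)[OF that(2)] k by (simp add: divide_right_mono)
    also have "\<dots> < e" using e M by (simp add: \<kappa>_def)
    finally have "x - (1 / \<kappa>) *\<^sub>R v \<in> ball x e" by (simp add: dist_norm)
    then have "x - (1 / \<kappa>) *\<^sub>R v \<in> C" using e(2) that(1) by blast
    then have "\<kappa> *\<^sub>R (x - (1 / \<kappa>) *\<^sub>R v) \<in> C" using scale_C k by blast
    then show ?thesis using k by (simp add: le_def algebra_simps)
  qed
  then show ?thesis using k by blast
qed

text \<open>Apply \<open>near_facet\<close> to \<open>z = x + \<tau> u\<close>, where \<open>u\<close> is the normalized vertex opposite to the facet
  of \<open>x\<close>. If the resulting \<open>y\<close> lies in the facet of \<open>x\<close> itself, write \<open>x = s y + c\<close> with \<open>c\<close> in a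
  common face. Then \<open>s z + c\<close> is close to \<open>x\<close>, and it is dominated by its part \<open>p = s \<tau> u + c\<close> in
  another facet once \<open>\<tau>\<close> is large, because this forces \<open>s\<close> to be small.\<close>

lemma near_other_facet:
  assumes "\<nexists>w. embedded_simplex_cone m w"
  shows "\<exists>\<beta>\<ge>1. \<forall>v i x. i \<le> m \<longrightarrow> (\<forall>l\<le>m. v l \<in> C) \<longrightarrow> x \<in> cone_span ({..m} - {i}) v \<longrightarrow> x \<in> C \<longrightarrow>
    (\<exists>j\<in>{..m} - {i}. \<exists>y\<in>cone_span ({..m} - {j}) v. x \<preceq> y \<and> y \<preceq> \<beta> *\<^sub>R x)"
proof -
  obtain D where D: "1 \<le> D" and near: "\<And>v z. (\<forall>l\<le>m. v l \<in> C) \<Longrightarrow> z \<in> cone_span {..m} v \<Longrightarrow> z \<in> C \<Longrightarrow>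
    \<exists>j\<le>m. \<exists>y\<in>cone_span ({..m} - {j}) v. z \<preceq> y \<and> y \<preceq> D *\<^sub>R z"
    using near_facet[OF assms] by blast
  obtain \<kappa> where \<kappa>: "0 < \<kappa>" "\<And>x v. x \<in> K \<Longrightarrow> v \<in> B \<Longrightarrow> v \<preceq> \<kappa> *\<^sub>R x"
    using section_le_K by blast
  obtain M where M: "0 < M" "\<And>x. x \<in> K \<Longrightarrow> a \<bullet> x \<le> M"
  proof -
    obtain N where N: "0 < N" "\<And>x. x \<in> K \<Longrightarrow> norm x \<le> N"
      using compact_imp_bounded[OF compact_K] by (auto simp: bounded_pos)
    have "a \<bullet> x \<le> norm a * N + 1" if "x \<in> K" for x
      using norm_cauchy_schwarz[of a x] mult_left_mono[OF N(2)[OF that], of "norm a"] by simp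
    then show ?thesis using that[of "norm a * N + 1"] N(1) by (smt (verit) mult_nonneg_nonneg norm_ge_zero)
  qed
  \<comment> \<open>Chosen so that the later estimate \<open>s * \<tau> \<le> M\<close> becomes
    \<open>D * s \<le> 1 / 2\<close>.\<close>
  define \<tau> where "\<tau> = 2 * D * M"
  \<comment> \<open>The two cases below need the factors \<open>D * (1 + \<tau> * \<kappa>)\<close>
    and \<open>2 * D\<close>; the product form dominates both.\<close>
  define \<beta> where "\<beta> = 2 * D * (1 + \<tau> * \<kappa>)"
  have \<tau>: "0 < \<tau>" using D M(1) by (simp add: \<tau>_def)
  then have "0 \<le> \<tau> * \<kappa>" using \<kappa>(1) by simp
  then have "0 \<le> D * (\<tau> * \<kappa>)" using D by simp
  moreover have "\<beta> = 2 * D + 2 * (D * (\<tau> * \<kappa>))" "D * (1 + \<tau> * \<kappa>) = D + D * (\<tau> * \<kappa>)"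
    by (simp_all add: \<beta>_def algebra_simps)
  ultimately have \<beta>: "2 * D \<le> \<beta>" "D * (1 + \<tau> * \<kappa>) \<le> \<beta>"
    using D by linarith+
  \<comment> \<open>The bounds \<open>M\<close> and \<kappa> are uniform only over \<open>K\<close>.
    Other points of \<open>C\<close> are brought into \<open>K\<close> by an automorphism at the
    end.\<close>
  have in_K: "\<exists>j\<in>{..m} - {i}. \<exists>y\<in>cone_span ({..m} - {j}) v. x \<preceq> y \<and> y \<preceq> \<beta> *\<^sub>R x"
    if i: "i \<le> m" and v: "\<forall>l\<le>m. v l \<in> C" and x: "x \<in> cone_span ({..m} - {i}) v" "x \<in> K" for v i x
  proof -
    have xC: "x \<in> C" using x(2) K_sub by blast
    define u where "u = (1 / (a \<bullet> v i)) *\<^sub>R v i"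
    have u: "u \<in> B" "u \<in> C" "a \<bullet> u = 1" using normalize_B[of "v i"] v i by (auto simp: u_def B_def)
    have vi_pos: "0 < a \<bullet> v i" using pos_C v i by blast
    have u_span: "t *\<^sub>R u \<in> cone_span ({..m} - {j}) v" if "0 \<le> t" "j \<noteq> i" for t j
      unfolding u_def using that i vi_pos
      by (intro cone_span_scale cone_span_generator) auto
    define z where "z = x + \<tau> *\<^sub>R u"
    have tu: "\<tau> *\<^sub>R u \<in> C" using scale_C u(2) \<tau> by blast
    have xz: "x \<preceq> z" using C_le[OF tu] by (simp add: le_def z_def)
    have zC: "z \<in> C" using add_C[OF xC tu] by (simp add: z_def)
    have "z \<in> cone_span {..m} v"
      unfolding z_def
    proof (rule cone_span_add)
      show "x \<in> cone_span {..m} v" using cone_span_mono[OF x(1)] by simp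
      show "\<tau> *\<^sub>R u \<in> cone_span {..m} v"
        unfolding u_def using i vi_pos \<tau> by (intro cone_span_scale cone_span_generator) auto
    qed
    then obtain j y where j: "j \<le> m" and y: "y \<in> cone_span ({..m} - {j}) v" "z \<preceq> y" "y \<preceq> D *\<^sub>R z"
      using near[OF v _ zC] by blast
    show ?thesis
    proof (cases "j = i")
      case False
      have "\<tau> *\<^sub>R u \<preceq> (\<tau> * \<kappa>) *\<^sub>R x"
        using le_scale[OF \<kappa>(2)[OF x(2) u(1)], of \<tau>] \<tau> by simp
      then have "z \<preceq> (1 + \<tau> * \<kappa>) *\<^sub>R x"
        using le_add[OF le_refl[of x]] by (simp add: z_def scaleR_add_left)
      then have "D *\<^sub>R z \<preceq> (D * (1 + \<tau> * \<kappa>)) *\<^sub>R x" using le_scale[of _ _ D] D by fastforce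
      moreover have "(D * (1 + \<tau> * \<kappa>)) *\<^sub>R x \<preceq> \<beta> *\<^sub>R x"
        using \<beta>(2) C_le[OF xC] by (intro le_scale_left)
      ultimately have "y \<preceq> \<beta> *\<^sub>R x" using y(3) le_trans by blast
      moreover have "x \<preceq> y" using xz y(2) le_trans by blast
      ultimately show ?thesis using j False y(1) by blast
    next
      case True
      let ?I = "{..m} - {i}"
      obtain b where b: "\<And>l. l \<in> ?I \<Longrightarrow> 0 \<le> b l" "y = (\<Sum>l\<in>?I. b l *\<^sub>R v l)"
        using y(1) True unfolding cone_span_def by blast
      have "y \<in> C" using in_C_le zC y(2) by blast
      then have "y \<noteq> 0" using not_zero_C by auto
      then obtain k where "k \<in> ?I" "b k \<noteq> 0" using b(2) by (metis (no_types, lifting) scale_eq_0_iff sum.neutral)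
      then have k: "k \<in> ?I" "0 < b k" using b(1) by (auto simp: less_le)
      obtain s j' c where s: "0 \<le> s" and j': "j' \<in> ?I" and c: "c \<in> cone_span (?I - {j'}) v"
        and xs: "x = s *\<^sub>R y + c"
        using cone_span_exhaust[OF _ x(1) b(2) k] by blast
      have c0: "0 \<preceq> c" using cone_span_ge_0[OF _ _ c] v by simp
      define p where "p = (s * \<tau>) *\<^sub>R u + c"
      have p_span: "p \<in> cone_span ({..m} - {j'}) v"
        unfolding p_def
      proof (rule cone_span_add)
        show "(s * \<tau>) *\<^sub>R u \<in> cone_span ({..m} - {j'}) v" using u_span s \<tau> j' by simp
        show "c \<in> cone_span ({..m} - {j'}) v" using c by (rule cone_span_mono) auto
      qed
      \<comment> \<open>The vector \<open>s x + p\<close> is \<open>s z + c\<close>, while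
        \<open>x\<close> is \<open>s y + c\<close>. The bounds
        \<open>z \<preceq> y \<preceq> D z\<close> therefore compare \<open>x\<close> with it from
        both sides.\<close>
      have low: "s *\<^sub>R x + p \<preceq> x"
        using le_add[OF le_scale[OF y(2) s] le_refl[of c]] xs
        by (simp add: z_def p_def scaleR_add_right add.assoc)
      have "c \<preceq> D *\<^sub>R c" using le_scale_left[OF c0 D] by simp
      then have "s *\<^sub>R y + c \<preceq> s *\<^sub>R D *\<^sub>R z + D *\<^sub>R c" by (intro le_add le_scale y(3) s)
      also have "s *\<^sub>R D *\<^sub>R z + D *\<^sub>R c = (D * s) *\<^sub>R x + D *\<^sub>R p"
        by (simp add: z_def p_def algebra_simps)
      finally have up: "x \<preceq> (D * s) *\<^sub>R x + D *\<^sub>R p" using xs by simp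
      have p0: "0 \<preceq> p"
        using cone_span_ge_0[OF _ _ p_span] v by simp
      \<comment> \<open>Evaluating \<open>a\<close> turns the lower comparison into numbers:
        \<open>x\<close> and \<open>c\<close> contribute nonnegative terms and
        \<open>s \<tau> u\<close> contributes \<open>s * \<tau>\<close>.\<close>
      have "a \<bullet> (s *\<^sub>R x + p) \<le> a \<bullet> x" using le_inner[OF low] .
      moreover have "0 \<le> s * (a \<bullet> x)" using s pos_C[OF xC] by simp
      moreover have "0 \<le> a \<bullet> c" using le_inner[OF c0] by simp
      ultimately have "s * \<tau> \<le> M"
        using M(2)[OF x(2)] by (simp add: p_def inner_add_right u(3))
      then have "D * s \<le> 1 / 2" using M(1) by (simp add: \<tau>_def field_simps)
      then have "(D * s) *\<^sub>R x \<preceq> (1 / 2) *\<^sub>R x" using C_le[OF xC] by (intro le_scale_left)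
      then have "x \<preceq> (1 / 2) *\<^sub>R x + D *\<^sub>R p"
        using up le_add[OF _ le_refl] le_trans by blast
      \<comment> \<open>The order depends on differences only, so half of \<open>x\<close> cancels
        and \<open>p\<close> alone has to dominate the other half up to the factor
        \<open>D\<close>.\<close>
      moreover have "x = (1 / 2) *\<^sub>R x + (1 / 2) *\<^sub>R x" by (simp flip: scaleR_add_left)
      ultimately have "(1 / 2) *\<^sub>R x \<preceq> D *\<^sub>R p"
        unfolding le_def by (metis add_diff_cancel_left)
      then have xp: "x \<preceq> (2 * D) *\<^sub>R p" using le_scale[of "(1 / 2) *\<^sub>R x" "D *\<^sub>R p" 2] by simp
      have "0 \<preceq> s *\<^sub>R x" using le_scale[OF C_le[OF xC] s] by simp
      then have "p \<preceq> x" using le_add[OF _ le_refl[of p]] low le_trans by fastforce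
      then have "(2 * D) *\<^sub>R p \<preceq> (2 * D) *\<^sub>R x" using D by (intro le_scale) auto
      then have "(2 * D) *\<^sub>R p \<preceq> \<beta> *\<^sub>R x"
        using le_scale_left[OF C_le[OF xC] \<beta>(1)] le_trans by blast
      moreover have "(2 * D) *\<^sub>R p \<in> cone_span ({..m} - {j'}) v"
        using p_span D by (intro cone_span_scale) auto
      ultimately show ?thesis using j' xp by blast
    qed
  qed
  have "\<exists>j\<in>{..m} - {i}. \<exists>y\<in>cone_span ({..m} - {j}) v. x \<preceq> y \<and> y \<preceq> \<beta> *\<^sub>R x"
    if i: "i \<le> m" and v: "\<forall>l\<le>m. v l \<in> C" and x: "x \<in> cone_span ({..m} - {i}) v" "x \<in> C" for v i x
  proof -
    obtain f g where fg: "linear f" "linear g" "\<And>v. f (g v) = v" "f ` C \<subseteq> C" "g ` C \<subseteq> C" "g x \<in> K"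
      using cocompact[OF x(2)] by blast
    have "\<forall>l\<le>m. g (v l) \<in> C" using v fg(5) by blast
    then obtain j y where j: "j \<in> {..m} - {i}" and y: "y \<in> cone_span ({..m} - {j}) (\<lambda>l. g (v l))"
      "g x \<preceq> y" "y \<preceq> \<beta> *\<^sub>R g x"
      using in_K[OF i _ cone_span_linear_image[OF fg(2) x(1)] fg(6)] by blast
    have "f y \<in> cone_span ({..m} - {j}) v"
      using cone_span_linear_image[OF fg(1) y(1)] fg(3) by simp
    moreover have "x \<preceq> f y" using le_linear[OF fg(1,4) y(2)] fg(3) by simp
    moreover have "f y \<preceq> \<beta> *\<^sub>R x" using le_linear[OF fg(1,4) y(3)] fg(1,3) by (simp add: linear_scale)
    ultimately show ?thesis using j by blast
  qed
  moreover have "1 \<le> \<beta>" using \<beta>(1) D by linarith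
  ultimately show ?thesis by blast
qed

text \<open>After a change of sign, a nontrivial relation is a representation of 0 with a positive
  coefficient. Splitting multiples of it off an interior point does not change the point but
  exhausts a generator, so a facet would meet \<open>C\<close>.\<close>

lemma embedded_simplex_cone_independent:
  assumes "embedded_simplex_cone m w" and "(\<Sum>l\<le>m. d l *\<^sub>R w l) = 0" and "l \<le> m"
  shows "d l = 0"
proof (rule ccontr)
  assume "d l \<noteq> 0"
  obtain x where x: "x \<in> cone_span {..m} w" "x \<in> C"
    using assms(1) by (auto simp: embedded_simplex_cone_def)
  define b where "b k = (if d l > 0 then d k else - d k)" for k
  have "0 = (\<Sum>k\<le>m. b k *\<^sub>R w k)"
    using assms(2) by (cases "d l > 0") (simp_all add: b_def sum_negf)
  moreover have "l \<in> {..m}" "0 < b l" using assms(3) \<open>d l \<noteq> 0\<close> by (auto simp: b_def)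
  ultimately obtain s j c where "j \<in> {..m}" "c \<in> cone_span ({..m} - {j}) w" "x = s *\<^sub>R 0 + c"
    using cone_span_exhaust[OF _ x(1), of 0 b l] by blast
  then show False using assms(1) x(2) by (auto simp: embedded_simplex_cone_def)
qed

end

section \<open>Projective points and affine charts\<close>

lemma subspace_line_of: "subspace (line_of p)" and dim_line_of: "dim (line_of p) = 1"
  using line_of[of p] by auto

lemma line_of_proj_pt: "v \<noteq> 0 \<Longrightarrow> line_of (proj_pt v) = span {v}"
  unfolding proj_pt_def by (intro Abs_proj_inverse) (simp add: subspace_span)

lemma line_of_eq_span:
  assumes "v \<in> line_of p" "v \<noteq> 0" shows "line_of p = span {v}"
proof -
  have "span {v} \<subseteq> line_of p" using assms(1) subspace_line_of[of p] by (intro span_minimal) auto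
  then show ?thesis
    using subspace_dim_equal[OF subspace_span subspace_line_of] assms(2) dim_line_of[of p]
    by (metis dim_singleton dim_span order_refl)
qed

lemma proj_pt_unique: "v \<in> line_of p \<Longrightarrow> v \<noteq> 0 \<Longrightarrow> proj_pt v = p"
  using line_of_eq_span by (metis line_of_inverse proj_pt_def)

lemma proj_pt_scale: "v \<noteq> 0 \<Longrightarrow> t \<noteq> 0 \<Longrightarrow> proj_pt (t *\<^sub>R v) = proj_pt v"
  by (intro proj_pt_unique) (simp_all add: line_of_proj_pt span_mul span_base)

lemma proj_pt_surj: obtains v where "v \<noteq> 0" "proj_pt v = p"
proof -
  have "line_of p \<noteq> {0}" using dim_line_of[of p] by (metis dim_singleton zero_neq_one)
  then obtain v where "v \<in> line_of p" "v \<noteq> 0" using subspace_line_of[of p] subspace_0 by blast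
  then show ?thesis using that proj_pt_unique by blast
qed

lemma affine_coord_unique:
  assumes "v \<in> line_of p" "a \<bullet> v = 1" shows "affine_coord a p = v"
  unfolding affine_coord_def
proof (rule the_equality)
  fix u assume u: "u \<in> line_of p \<and> a \<bullet> u = 1"
  have "v \<noteq> 0" using assms(2) by auto
  then have "u \<in> span {v}" using u line_of_eq_span[OF assms(1)] by simp
  then obtain k where "u = k *\<^sub>R v" by (auto simp: span_singleton)
  then show "u = v" using u assms(2) by simp
qed (use assms in simp)

lemma affine_coord_proj_pt:
  assumes "a \<bullet> v \<noteq> 0" shows "affine_coord a (proj_pt v) = (1 / (a \<bullet> v)) *\<^sub>R v"
proof -
  have "v \<noteq> 0" using assms by auto
  then show ?thesis
    using assms by (intro affine_coord_unique) (simp_all add: line_of_proj_pt span_mul span_base)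
qed

lemma proj_pt_in_chart: "v \<noteq> 0 \<Longrightarrow> proj_pt v \<in> affine_chart a \<longleftrightarrow> a \<bullet> v \<noteq> 0"
  by (auto simp: affine_chart_def line_of_proj_pt span_singleton)

lemma affine_coord_in_chart:
  assumes "p \<in> affine_chart a"
  shows "a \<bullet> affine_coord a p = 1" "affine_coord a p \<in> line_of p" "proj_pt (affine_coord a p) = p"
proof -
  obtain v where v: "v \<noteq> 0" "p = proj_pt v" using proj_pt_surj by metis
  then have "a \<bullet> v \<noteq> 0" using assms proj_pt_in_chart by blast
  then have eq: "affine_coord a p = (1 / (a \<bullet> v)) *\<^sub>R v" and "v \<in> line_of p"
    using v affine_coord_proj_pt by (auto simp: line_of_proj_pt span_base)
  then show 1: "a \<bullet> affine_coord a p = 1" "affine_coord a p \<in> line_of p"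
    using \<open>a \<bullet> v \<noteq> 0\<close> subspace_line_of by (auto intro: subspace_scale)
  have "affine_coord a p \<noteq> 0" using 1 by auto
  then show "proj_pt (affine_coord a p) = p" using 1(2) proj_pt_unique by blast
qed

text \<open>Openness in the quotient topology is tested on nonzero vectors, where the affine
  coordinate is the map dividing \<open>v\<close> by \<open>a \<bullet> v\<close>, continuous off
  the hyperplane.\<close>

lemma open_affine_coord_vimage:
  assumes "open U" shows "open {p \<in> affine_chart a. affine_coord a p \<in> U}"
proof -
  have "{v. v \<noteq> 0 \<and> proj_pt v \<in> {p \<in> affine_chart a. affine_coord a p \<in> U}}
      = {v \<in> {v. a \<bullet> v \<noteq> 0}. (1 / (a \<bullet> v)) *\<^sub>R v \<in> U}"
    by (auto simp: proj_pt_in_chart affine_coord_proj_pt) (metis inner_zero_right proj_pt_in_chart)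
  moreover have "open \<dots>"
  proof -
    have "continuous_on {v. a \<bullet> v \<noteq> 0} (\<lambda>v. (1 / (a \<bullet> v)) *\<^sub>R v)"
      by (intro continuous_intros) auto
    then have "open ({v. a \<bullet> v \<noteq> 0} \<inter> (\<lambda>v. (1 / (a \<bullet> v)) *\<^sub>R v) -` U)"
      by (rule continuous_open_preimage) (intro open_Collect_neq continuous_intros assms)+
    then show ?thesis by (simp add: vimage_def Int_def)
  qed
  ultimately show ?thesis unfolding open_proj_def by simp
qed

lemma continuous_on_affine_coord: "continuous_on (affine_chart a) (affine_coord a)"
proof -
  have "open (affine_coord a -` U \<inter> affine_chart a)" if "open U" for U
    using open_affine_coord_vimage[OF that, of a] by (simp add: vimage_def Int_def conj_commute)
  moreover have "open (affine_chart a)"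
    using open_affine_coord_vimage[of UNIV a] by simp
  ultimately show ?thesis by (simp add: continuous_on_open_vimage)
qed

lemma invertible_mult_eq_0:
  fixes A :: "real^'n^'n"
  shows "invertible A \<Longrightarrow> A *v v = 0 \<longleftrightarrow> v = 0"
  using matrix_left_invertible_ker[of A] by (auto simp: invertible_def)

lemma proj_action_proj_pt:
  assumes "invertible A" "v \<noteq> 0" shows "proj_action A (proj_pt v) = proj_pt (A *v v)"
proof -
  have "(*v) A ` span {v} = span {A *v v}"
    using linear_span_image[OF matrix_vector_mul_linear[of A], of "{v}"] by simp
  then show ?thesis unfolding proj_action_def line_of_proj_pt[OF assms(2)] by (simp add: proj_pt_def)
qed

section \<open>The cone over a properly convex domain\<close>

locale convex_projective_domain =
  fixes \<Omega> :: "('n::finite) proj set"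
  assumes pcd: "properly_convex_domain \<Omega>"
begin

definition a :: "real^'n" where "a = (SOME a. convex_chart \<Omega> a)"

text \<open>The preimage of \<Omega> consists of two opposite cones; the sign of \<open>a\<close>
  selects one.\<close>

definition C :: "(real^'n) set" where "C = {v. 0 < a \<bullet> v \<and> proj_pt v \<in> \<Omega>}"

definition B :: "(real^'n) set" where "B = {x \<in> C. a \<bullet> x = 1}"

lemma chart: "convex_chart \<Omega> a"
  unfolding a_def using pcd someI_ex[of "convex_chart \<Omega>"] by (simp add: properly_convex_domain_def)

lemma coord_eq: "coord \<Omega> = affine_coord a"
  by (simp add: coord_def a_def)

lemma closure_sub_chart: "closure \<Omega> \<subseteq> affine_chart a"
  using chart by (simp add: convex_chart_def)

lemma open_\<Omega>: "open \<Omega>" using pcd by (simp add: properly_convex_domain_def)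

lemma coord_closure:
  assumes "p \<in> closure \<Omega>"
  shows "a \<bullet> coord \<Omega> p = 1" "coord \<Omega> p \<in> line_of p" "proj_pt (coord \<Omega> p) = p"
proof -
  have "p \<in> affine_chart a" using closure_sub_chart assms by blast
  then show "a \<bullet> coord \<Omega> p = 1" "coord \<Omega> p \<in> line_of p" "proj_pt (coord \<Omega> p) = p"
    unfolding coord_eq by (rule affine_coord_in_chart)+
qed

lemma coord_proj_pt: "a \<bullet> v \<noteq> 0 \<Longrightarrow> coord \<Omega> (proj_pt v) = (1 / (a \<bullet> v)) *\<^sub>R v"
  by (simp add: coord_eq affine_coord_proj_pt)

lemma coord_in_B: "p \<in> \<Omega> \<Longrightarrow> coord \<Omega> p \<in> B"
  using coord_closure[of p] closure_subset[of \<Omega>] by (auto simp: B_def C_def)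

lemma B_eq: "B = coord \<Omega> ` \<Omega>"
proof -
  have "x \<in> coord \<Omega> ` \<Omega>" if "x \<in> B" for x
    using that coord_proj_pt[of x] by (force simp: B_def C_def)
  then show ?thesis using coord_in_B by blast
qed

lemma convex_B: "convex B" and bounded_B: "bounded B"
  using chart unfolding B_eq coord_eq by (simp_all add: convex_chart_def)

lemma scale_C: "x \<in> C \<Longrightarrow> 0 < t \<Longrightarrow> t *\<^sub>R x \<in> C"
  using proj_pt_scale[of x t] by (cases "x = 0") (auto simp: C_def)

lemma normalize_C: "x \<in> C \<Longrightarrow> (1 / (a \<bullet> x)) *\<^sub>R x \<in> B"
  using scale_C[of x "1 / (a \<bullet> x)"] by (simp add: B_def C_def)

text \<open>Up to a positive factor, the sum is the convex combination of the normalized vectors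
  with weights proportional to their values under \<open>a\<close>.\<close>

lemma add_C: assumes "x \<in> C" "y \<in> C" shows "x + y \<in> C"
proof -
  define s t where "s = a \<bullet> x" and "t = a \<bullet> y"
  have st: "0 < s" "0 < t" using assms by (auto simp: s_def t_def C_def)
  have "(s / (s + t)) *\<^sub>R (1 / s) *\<^sub>R x + (t / (s + t)) *\<^sub>R (1 / t) *\<^sub>R y \<in> B"
    using normalize_C[OF assms(1)] normalize_C[OF assms(2)] st unfolding s_def[symmetric] t_def[symmetric]
    by (intro convexD[OF convex_B]) (auto simp: add_divide_distrib[symmetric])
  then have "(s + t) *\<^sub>R ((s / (s + t)) *\<^sub>R (1 / s) *\<^sub>R x + (t / (s + t)) *\<^sub>R (1 / t) *\<^sub>R y) \<in> C"
    using st by (intro scale_C) (auto simp: B_def)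
  then show ?thesis using st by (simp add: scaleR_add_right)
qed

lemma open_C: "open C"
proof -
  have "C = {v. v \<noteq> 0 \<and> proj_pt v \<in> \<Omega>} \<inter> {v. 0 < a \<bullet> v}" by (auto simp: C_def)
  then show ?thesis
    using open_\<Omega> open_halfspace_gt[of 0 a] by (simp add: open_proj_def open_Int)
qed

lemma closure_B_inner: "x \<in> closure B \<Longrightarrow> a \<bullet> x = 1"
proof -
  have "closure B \<subseteq> {x. a \<bullet> x = 1}"
    by (rule closure_minimal) (auto simp: B_def closed_hyperplane)
  then show "x \<in> closure B \<Longrightarrow> a \<bullet> x = 1" by auto
qed

text \<open>The two closures belong to different topologies. An open set of the chart that misses
  \<open>B\<close> pulls back to a projective open set that misses \<Omega>; the next lemma argues
  the same way in the opposite direction.\<close>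

lemma coord_in_closure: assumes "p \<in> closure \<Omega>" shows "coord \<Omega> p \<in> closure B"
proof (rule ccontr)
  assume neg: "coord \<Omega> p \<notin> closure B"
  let ?U = "{q \<in> affine_chart a. affine_coord a q \<in> - closure B}"
  have U: "open ?U" by (intro open_affine_coord_vimage open_Compl closed_closure)
  have "p \<in> ?U" using assms neg closure_sub_chart by (auto simp: coord_eq)
  then have "?U \<inter> closure \<Omega> \<noteq> {}" using assms by blast
  then have "?U \<inter> \<Omega> \<noteq> {}" unfolding open_Int_closure_eq_empty[OF U] .
  then obtain q where "q \<in> \<Omega>" "coord \<Omega> q \<notin> closure B" by (auto simp: coord_eq)
  then show False using coord_in_B closure_subset[of B] by blast
qed

lemma proj_pt_in_closure: assumes "x \<in> closure B" shows "proj_pt x \<in> closure \<Omega>"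
proof (rule ccontr)
  assume neg: "proj_pt x \<notin> closure \<Omega>"
  let ?U = "{v. v \<noteq> 0 \<and> proj_pt v \<in> - closure \<Omega>}"
  have U: "open ?U" using open_Compl[OF closed_closure[of \<Omega>]] unfolding open_proj_def .
  have "x \<noteq> 0" using closure_B_inner[OF assms] by auto
  then have "?U \<inter> closure B \<noteq> {}" using neg assms by blast
  then have "?U \<inter> B \<noteq> {}" unfolding open_Int_closure_eq_empty[OF U] .
  then obtain v where "proj_pt v \<notin> closure \<Omega>" "proj_pt v \<in> \<Omega>" by (auto simp: B_def C_def)
  then show False using closure_subset[of \<Omega>] by blast
qed

lemma coord_closure_image: "coord \<Omega> ` closure \<Omega> = closure B"
proof -
  have "x \<in> coord \<Omega> ` closure \<Omega>" if "x \<in> closure B" for x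
    using proj_pt_in_closure[OF that] coord_proj_pt[of x] closure_B_inner[OF that] by force
  then show ?thesis using coord_in_closure by blast
qed

lemma inj_on_coord: "inj_on (coord \<Omega>) (closure \<Omega>)"
  by (metis coord_closure(3) inj_onI)

text \<open>The intersection defining \<open>CH\<close> is attained: the coordinate hull stays in
  the convex set \<open>closure B\<close>, so its preimage in \<open>closure \<Omega>\<close> is
  itself a competitor. Injectivity of coordinates places it inside all others.\<close>

lemma mem_CH:
  assumes "X \<subseteq> closure \<Omega>"
  shows "p \<in> CH \<Omega> X \<longleftrightarrow> p \<in> closure \<Omega> \<and> coord \<Omega> p \<in> convex hull (coord \<Omega> ` X)"
proof
  let ?D = "{p \<in> closure \<Omega>. coord \<Omega> p \<in> convex hull (coord \<Omega> ` X)}"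
  have "convex hull (coord \<Omega> ` X) \<subseteq> closure B"
    using assms coord_in_closure convex_closure[OF convex_B] by (intro hull_minimal) auto
  then have "coord \<Omega> ` ?D = convex hull (coord \<Omega> ` X)"
    unfolding coord_closure_image[symmetric] by auto
  then have "?D \<in> {D. D \<subseteq> closure \<Omega> \<and> convex (coord \<Omega> ` D) \<and> X \<subseteq> D}"
    using assms by (auto simp: hull_inc convex_convex_hull)
  then show "p \<in> CH \<Omega> X \<Longrightarrow> p \<in> closure \<Omega> \<and> coord \<Omega> p \<in> convex hull (coord \<Omega> ` X)"
    unfolding CH_def by blast
next
  assume p: "p \<in> closure \<Omega> \<and> coord \<Omega> p \<in> convex hull (coord \<Omega> ` X)"
  have "p \<in> D" if D: "D \<subseteq> closure \<Omega>" "convex (coord \<Omega> ` D)" "X \<subseteq> D" for D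
  proof -
    have "convex hull (coord \<Omega> ` X) \<subseteq> coord \<Omega> ` D" using D by (intro hull_minimal image_mono)
    then obtain q where "q \<in> D" "coord \<Omega> p = coord \<Omega> q" using p by blast
    then show ?thesis using p D(1) inj_on_coord by (metis inj_onD subsetD)
  qed
  then show "p \<in> CH \<Omega> X" unfolding CH_def by blast
qed

section \<open>The Hilbert metric along a chord\<close>

text \<open>With \<open>x\<close> at parameter 0 and \<open>y\<close> at parameter 1, the parameters
  in \<open>closure B\<close> form a compact interval because \<open>B\<close> is convex and
  bounded. Openness of \<open>C\<close> keeps 0 and 1 away from its ends and the ends outside
  \<Omega>.\<close>

lemma chord_parametrization:
  assumes xy: "x \<in> \<Omega>" "y \<in> \<Omega>" "x \<noteq> y"
  defines "L \<equiv> \<lambda>t. coord \<Omega> x + t *\<^sub>R (coord \<Omega> y - coord \<Omega> x)"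
  obtains t0 t1 where "t0 < 0" "1 < t1" "{t. L t \<in> closure B} = {t0..t1}"
    "chord_endpoints \<Omega> x y (proj_pt (L t0)) (proj_pt (L t1))"
proof -
  let ?X = "coord \<Omega> x" and ?Y = "coord \<Omega> y"
  have cl: "x \<in> closure \<Omega>" "y \<in> closure \<Omega>" using xy closure_subset by auto
  have XB: "?X \<in> B" "?Y \<in> B" using xy coord_in_B by auto
  have neq: "?X \<noteq> ?Y" using xy(3) coord_closure(3) cl by metis
  have aL: "a \<bullet> L t = 1" for t using coord_closure(1) cl by (simp add: L_def inner_add_right inner_diff_right)
  have contL: "continuous_on UNIV L" unfolding L_def by (intro continuous_intros)
  let ?T = "{t. L t \<in> closure B}"
  have L_affine: "L ((1 - u) * s + u * t) = (1 - u) *\<^sub>R L s + u *\<^sub>R L t" for u s t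
    by (simp add: L_def algebra_simps)
  have "closed ?T"
    using continuous_closed_preimage[OF contL closed_UNIV closed_closure[of B]] by (simp add: vimage_def)
  moreover have "bounded ?T"
  proof -
    obtain M where M: "\<And>z. z \<in> closure B \<Longrightarrow> norm z \<le> M"
      using bounded_closure[OF bounded_B] by (auto simp: bounded_iff)
    have "\<bar>t\<bar> \<le> (M + norm ?X) / norm (?Y - ?X)" if "t \<in> ?T" for t
    proof -
      have "\<bar>t\<bar> * norm (?Y - ?X) = norm (L t - ?X)" by (simp add: L_def)
      also have "\<dots> \<le> norm (L t) + norm ?X" by (rule norm_triangle_ineq4)
      also have "\<dots> \<le> M + norm ?X" using M that by simp
      finally show ?thesis using neq by (simp add: field_simps)
    qed
    then show ?thesis by (auto simp: bounded_iff)
  qed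
  ultimately have cT: "compact ?T" by (simp add: compact_eq_bounded_closed)
  have convT: "convex ?T"
  proof (rule convexI)
    fix s t u v :: real assume st: "s \<in> ?T" "t \<in> ?T" and uv: "0 \<le> u" "0 \<le> v" "u + v = 1"
    have "u = 1 - v" using uv(3) by simp
    then have "L (u *\<^sub>R s + v *\<^sub>R t) = u *\<^sub>R L s + v *\<^sub>R L t" using L_affine by simp
    then show "u *\<^sub>R s + v *\<^sub>R t \<in> ?T"
      using convexD[OF convex_closure[OF convex_B] _ _ uv] st by simp
  qed
  then obtain t0 t1 where T: "?T = {t0..t1}"
    using connected_compact_interval_1[of ?T] cT convex_connected[OF convT] by blast
  have openT: "open {t. L t \<in> C}"
    using continuous_open_preimage[OF contL open_UNIV open_C] by (simp add: vimage_def)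
  have CT: "t \<in> {t0..t1}" if "L t \<in> C" for t
    using that aL closure_subset[of B] unfolding T[symmetric] by (auto simp: B_def)
  have interior: "t0 < t \<and> t < t1" if "L t \<in> C" for t
  proof -
    have "t \<in> {t. L t \<in> C}" using that by simp
    then obtain e where e: "e > 0" "ball t e \<subseteq> {t. L t \<in> C}" by (rule openE[OF openT])
    have "t - e / 2 \<in> ball t e" "t + e / 2 \<in> ball t e" using e(1) by (auto simp: dist_real_def)
    then have "t - e / 2 \<in> {t0..t1}" "t + e / 2 \<in> {t0..t1}" using e(2) CT by fast+
    then show ?thesis using e(1) by auto
  qed
  have "L 0 \<in> C" "L 1 \<in> C" using XB by (auto simp: L_def B_def)
  then have t01: "t0 < 0" "1 < t1" using interior by blast+
  have seg: "L ` {s..t} = closed_segment (L s) (L t)" if "s \<le> t" for s t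
  proof -
    have "closed_segment (L s) (L t) = L ` closed_segment s t"
      unfolding closed_segment_image_interval image_image by (simp add: L_affine)
    then show ?thesis using that by (simp add: closed_segment_eq_real_ivl)
  qed
  have ends: "proj_pt (L t) \<in> bdry \<Omega>" "coord \<Omega> (proj_pt (L t)) = L t" if "t = t0 \<or> t = t1" for t
  proof -
    have "t \<in> ?T" unfolding T using that t01 by auto
    then have "proj_pt (L t) \<in> closure \<Omega>" using proj_pt_in_closure by blast
    moreover have "L t \<notin> C" using interior[of t] that by auto
    ultimately show "proj_pt (L t) \<in> bdry \<Omega>" using aL[of t] by (simp add: C_def bdry_def)
    show "coord \<Omega> (proj_pt (L t)) = L t" using coord_proj_pt[of "L t"] aL by simp
  qed
  have "coord \<Omega> ` (proj_line x y \<inter> closure \<Omega>) = L ` {t0..t1}"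
  proof (intro equalityI subsetI)
    fix z assume "z \<in> coord \<Omega> ` (proj_line x y \<inter> closure \<Omega>)"
    then obtain p where p: "p \<in> closure \<Omega>" "line_of p \<subseteq> span (line_of x \<union> line_of y)" "z = coord \<Omega> p"
      by (auto simp: proj_line_def)
    have "line_of x = span {?X}" "line_of y = span {?Y}"
      using coord_closure(1,2) cl by (metis inner_zero_right line_of_eq_span zero_neq_one)+
    then have "line_of x \<union> line_of y \<subseteq> span {?X, ?Y}"
      using span_mono[of "{?X}" "{?X, ?Y}"] span_mono[of "{?Y}" "{?X, ?Y}"] by simp
    then have "span (line_of x \<union> line_of y) \<subseteq> span {?X, ?Y}"
      by (intro span_minimal subspace_span)
    then have "z \<in> span {?X, ?Y}" using p coord_closure(2) by blast
    then obtain r where "z - r *\<^sub>R ?X \<in> span {?Y}" by (auto simp: span_insert)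
    then obtain s where "z - r *\<^sub>R ?X = s *\<^sub>R ?Y" by (auto simp: span_singleton)
    then have rs: "z = r *\<^sub>R ?X + s *\<^sub>R ?Y" by (simp add: algebra_simps)
    \<comment> \<open>The projective line is a plane of vectors. On the hyperplane
      \<open>a = 1\<close> the coefficients of a combination add up to 1, which leaves the affine
      line \<open>L\<close>.\<close>
    have "a \<bullet> z = 1" "a \<bullet> ?X = 1" "a \<bullet> ?Y = 1" using coord_closure(1) p(1,3) cl by auto
    then have "r = 1 - s" unfolding rs by (simp add: inner_add_right)
    then have "z = (1 - s) *\<^sub>R ?X + s *\<^sub>R ?Y" unfolding rs by simp
    then have "z = L s" by (simp add: L_def algebra_simps)
    moreover have "z \<in> closure B" using coord_in_closure p by blast
    ultimately show "z \<in> L ` {t0..t1}" using T by blast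
  next
    fix z assume "z \<in> L ` {t0..t1}"
    then obtain t where t: "t \<in> {t0..t1}" "z = L t" by blast
    then have zB: "z \<in> closure B" using T by blast
    then have z: "proj_pt z \<in> closure \<Omega>" "coord \<Omega> (proj_pt z) = z"
      using proj_pt_in_closure coord_proj_pt[of z] closure_B_inner[of z] by auto
    have "?X \<in> span (line_of x \<union> line_of y)" "?Y \<in> span (line_of x \<union> line_of y)"
      using coord_closure(2) cl by (auto intro: span_base)
    then have "z \<in> span (line_of x \<union> line_of y)"
      unfolding t(2) L_def by (intro span_add span_scale span_diff)
    moreover have "line_of (proj_pt z) = span {z}" using closure_B_inner[OF zB] by (intro line_of_proj_pt) auto
    ultimately have "proj_pt z \<in> proj_line x y" by (simp add: proj_line_def span_minimal subspace_span)
    then show "z \<in> coord \<Omega> ` (proj_line x y \<inter> closure \<Omega>)" using z by (metis IntI imageI)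
  qed
  also have "\<dots> = closed_segment (L t0) (L t1)" using seg t01 by simp
  finally have chord: "coord \<Omega> ` (proj_line x y \<inter> closure \<Omega>) = closed_segment (L t0) (L t1)" .
  have XL: "?X = L 0" and YL: "?Y = L 1" by (auto simp: L_def)
  have "?X \<in> closed_segment (L t0) ?Y" "?Y \<in> closed_segment ?X (L t1)"
    unfolding XL YL using seg[of t0 1] seg[of 0 t1] t01 by force+
  then have "chord_endpoints \<Omega> x y (proj_pt (L t0)) (proj_pt (L t1))"
    unfolding chord_endpoints_def using ends chord by simp
  then show ?thesis using that t01 T by blast
qed

text \<open>Distances along the line are parameter differences times one constant, which cancels in
  the cross-ratio. The definite description also demands uniqueness: a segment determines its
  endpoints up to order, and betweenness fixes the order.\<close>

lemma hilbert_dist_eq: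
  assumes xy: "x \<in> \<Omega>" "y \<in> \<Omega>" "x \<noteq> y"
  defines "L \<equiv> \<lambda>t. coord \<Omega> x + t *\<^sub>R (coord \<Omega> y - coord \<Omega> x)"
  assumes t: "t0 < 0" "1 < t1"
    and ep: "chord_endpoints \<Omega> x y (proj_pt (L t0)) (proj_pt (L t1))"
  shows "hilbert_dist \<Omega> x y = 1 / 2 * ln (((1 - t0) * t1) / ((- t0) * (t1 - 1)))"
proof -
  let ?X = "coord \<Omega> x" and ?Y = "coord \<Omega> y"
  have cl: "x \<in> closure \<Omega>" "y \<in> closure \<Omega>" using xy closure_subset by auto
  have neq: "?X \<noteq> ?Y" using xy(3) coord_closure(3) cl by metis
  have aL: "a \<bullet> L t = 1" for t using coord_closure(1) cl by (simp add: L_def inner_add_right inner_diff_right)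
  have coordL: "coord \<Omega> (proj_pt (L t)) = L t" for t using coord_proj_pt[of "L t"] aL by simp
  have XL: "?X = L 0" and YL: "?Y = L 1" by (auto simp: L_def)
  have distL: "dist (L s) (L t) = \<bar>s - t\<bar> * dist ?X ?Y" for s t
  proof -
    have "L s - L t = (s - t) *\<^sub>R (?Y - ?X)" by (simp add: L_def algebra_simps)
    then show ?thesis by (simp add: dist_norm norm_minus_commute)
  qed
  let ?d = "dist ?X ?Y"
  let ?f = "\<lambda>p q. 1 / 2 * ln ((dist ?Y (coord \<Omega> p) * dist ?X (coord \<Omega> q)) /
    (dist ?X (coord \<Omega> p) * dist ?Y (coord \<Omega> q)))"
  have d: "?d > 0" using neq by simp
  have dX: "dist ?X (L t) = \<bar>t\<bar> * ?d" and dY: "dist ?Y (L t) = \<bar>t - 1\<bar> * ?d" for t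
    using distL[of 0 t] distL[of 1 t] by (simp_all add: XL[symmetric] YL[symmetric] abs_minus_commute)
  have "dist ?Y (L t0) * dist ?X (L t1) = ((1 - t0) * t1) * (?d * ?d)"
    "dist ?X (L t0) * dist ?Y (L t1) = ((- t0) * (t1 - 1)) * (?d * ?d)"
    unfolding dX dY using t by simp_all
  then have val: "?f (proj_pt (L t0)) (proj_pt (L t1)) = 1 / 2 * ln (((1 - t0) * t1) / ((- t0) * (t1 - 1)))"
    unfolding coordL using d by simp
  have unique: "?f p q = ?f (proj_pt (L t0)) (proj_pt (L t1))" if pq: "chord_endpoints \<Omega> x y p q" for p q
  proof -
    have "closed_segment (coord \<Omega> p) (coord \<Omega> q) = closed_segment (L t0) (L t1)"
      using pq ep coordL unfolding chord_endpoints_def by metis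
    then have "{coord \<Omega> p, coord \<Omega> q} = {L t0, L t1}" by (simp add: closed_segment_eq)
    then consider "coord \<Omega> p = L t0" "coord \<Omega> q = L t1" | "coord \<Omega> p = L t1" "coord \<Omega> q = L t0"
      by (metis doubleton_eq_iff)
    then show ?thesis
    proof cases
      case 1 then show ?thesis by (simp add: coordL)
    next
      case 2
      \<comment> \<open>With swapped endpoints \<open>x\<close> would lie between
        \<open>L t1\<close> and \<open>y\<close>, forcing \<open>t1 - 1 = t1 + 1\<close>.\<close>
      then have "?X \<in> closed_segment (L t1) ?Y" using pq by (simp add: chord_endpoints_def)
      then have "dist (L t1) ?Y = dist (L t1) ?X + ?d"
        unfolding between_mem_segment[symmetric] between .
      then have "\<bar>t1 - 1\<bar> * ?d = \<bar>t1\<bar> * ?d + ?d" using dX[of t1] dY[of t1] by (simp add: dist_commute)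
      then have "?d = 0" using t by (simp add: left_diff_distrib)
      then show ?thesis using d by simp
    qed
  qed
  have "(THE r. \<exists>p q. chord_endpoints \<Omega> x y p q \<and> r = ?f p q) = ?f (proj_pt (L t0)) (proj_pt (L t1))"
    using ep unique by (intro the_equality) blast+
  then show ?thesis unfolding hilbert_dist_def val[symmetric] using xy(3) by simp
qed

lemma hilbert_dist_cross_ratio:
  assumes "x \<in> \<Omega>" "y \<in> \<Omega>" "x \<noteq> y"
  obtains t0 t1 where "t0 < 0" "1 < t1"
    "{t. coord \<Omega> x + t *\<^sub>R (coord \<Omega> y - coord \<Omega> x) \<in> closure B} = {t0..t1}"
    "hilbert_dist \<Omega> x y = 1 / 2 * ln (((1 - t0) * t1) / ((- t0) * (t1 - 1)))"
proof (rule chord_parametrization[OF assms])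
  fix t0 t1
  assume t: "t0 < 0" "1 < t1"
    and T: "{t. coord \<Omega> x + t *\<^sub>R (coord \<Omega> y - coord \<Omega> x) \<in> closure B} = {t0..t1}"
    and ep: "chord_endpoints \<Omega> x y (proj_pt (coord \<Omega> x + t0 *\<^sub>R (coord \<Omega> y - coord \<Omega> x)))
      (proj_pt (coord \<Omega> x + t1 *\<^sub>R (coord \<Omega> y - coord \<Omega> x)))"
  show thesis by (rule that[OF t T hilbert_dist_eq[OF assms t ep]])
qed

text \<open>Supplies the lower bound required to estimate the infimum in
  \<open>hilbert_nbhd\<close>.\<close>

lemma hilbert_dist_nonneg:
  assumes "x \<in> \<Omega>" "y \<in> \<Omega>" shows "0 \<le> hilbert_dist \<Omega> x y"
proof (cases "x = y")
  case False
  obtain t0 t1 where t: "t0 < 0" "1 < t1"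
    and eq: "hilbert_dist \<Omega> x y = 1 / 2 * ln (((1 - t0) * t1) / ((- t0) * (t1 - 1)))"
    by (rule hilbert_dist_cross_ratio[OF assms False])
  have "0 < (- t0) * (t1 - 1)" using t by (intro mult_pos_pos) auto
  moreover have "(- t0) * (t1 - 1) \<le> (1 - t0) * t1" using t by (intro mult_mono) auto
  ultimately have "1 \<le> ((1 - t0) * t1) / ((- t0) * (t1 - 1))" by (simp only: pos_le_divide_eq)
  then show ?thesis unfolding eq by (simp add: ln_ge_zero)
qed (simp add: hilbert_dist_def)

text \<open>If \<open>x\<close> and \<open>y\<close> differ, both differences lie in
  \<open>C\<close> and normalize to points of the chord, with parameters \<open>c / (c - 1)\<close>
  and \<open>- c / (\<beta> - c)\<close>. Since these lie in \<open>[t0, t1]\<close>, the factors of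
  the cross-ratio satisfy \<open>t1 / (t1 - 1) \<le> c\<close> and
  \<open>(1 - t0) / (- t0) \<le> \<beta> / c\<close>, and \<open>c\<close> cancels in the
  product.\<close>

lemma hilbert_dist_le:
  assumes xy: "x \<in> \<Omega>" "y \<in> \<Omega>" and c: "0 < c" and \<beta>: "1 \<le> \<beta>"
    and low: "c *\<^sub>R coord \<Omega> y - coord \<Omega> x \<in> insert 0 C"
    and up: "\<beta> *\<^sub>R coord \<Omega> x - c *\<^sub>R coord \<Omega> y \<in> insert 0 C"
  shows "hilbert_dist \<Omega> x y \<le> 1 / 2 * ln \<beta>"
proof (cases "x = y")
  case True
  then show ?thesis using \<beta> by (simp add: hilbert_dist_def ln_ge_zero)
next
  case False
  obtain t0 t1 where t: "t0 < 0" "1 < t1"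
    and T: "{t. coord \<Omega> x + t *\<^sub>R (coord \<Omega> y - coord \<Omega> x) \<in> closure B} = {t0..t1}"
    and eq: "hilbert_dist \<Omega> x y = 1 / 2 * ln (((1 - t0) * t1) / ((- t0) * (t1 - 1)))"
    by (rule hilbert_dist_cross_ratio[OF xy False])
  define L where "L t = coord \<Omega> x + t *\<^sub>R (coord \<Omega> y - coord \<Omega> x)" for t
  have T: "{t. L t \<in> closure B} = {t0..t1}" using T by (simp add: L_def)
  let ?X = "coord \<Omega> x" and ?Y = "coord \<Omega> y"
  have cl: "x \<in> closure \<Omega>" "y \<in> closure \<Omega>" using xy closure_subset by auto
  have neq: "?X \<noteq> ?Y" using False coord_closure(3) cl by metis
  have aX: "a \<bullet> ?X = 1" "a \<bullet> ?Y = 1" using coord_closure(1) cl by auto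
  have aC: "a \<bullet> z > 0" if "z \<in> insert 0 C" "z \<noteq> 0" for z using that by (auto simp: C_def)
  \<comment> \<open>Distinct normalized points are not proportional, so neither difference vanishes.
    Evaluating \<open>a\<close> then gives \<open>1 < c < \<beta>\<close>, and the denominators are
    positive.\<close>
  have low': "c *\<^sub>R ?Y - ?X \<noteq> 0"
  proof
    assume z: "c *\<^sub>R ?Y - ?X = 0"
    then have "a \<bullet> (c *\<^sub>R ?Y - ?X) = 0" by simp
    then have "c = 1" using aX by (simp add: inner_diff_right)
    then show False using z neq by simp
  qed
  then have c1: "1 < c" using aC[OF low] aX by (simp add: inner_diff_right)
  have up': "\<beta> *\<^sub>R ?X - c *\<^sub>R ?Y \<noteq> 0"
  proof
    assume z: "\<beta> *\<^sub>R ?X - c *\<^sub>R ?Y = 0"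
    then have "a \<bullet> (\<beta> *\<^sub>R ?X - c *\<^sub>R ?Y) = 0" by simp
    then have "\<beta> = c" using aX by (simp add: inner_diff_right)
    then have "c *\<^sub>R (?X - ?Y) = 0" using z by (simp add: scaleR_diff_right)
    then show False using neq c by simp
  qed
  then have bc: "c < \<beta>" using aC[OF up] aX by (simp add: inner_diff_right)
  have "(1 / (c - 1)) *\<^sub>R (c *\<^sub>R ?Y - ?X) \<in> B"
    using normalize_C[of "c *\<^sub>R ?Y - ?X"] low low' aX by (simp add: inner_diff_right)
  moreover have "(1 / (c - 1)) *\<^sub>R (c *\<^sub>R ?Y - ?X) = L (c / (c - 1))"
  proof -
    have "(c - 1) *\<^sub>R L (c / (c - 1)) = (c - 1) *\<^sub>R ?X + c *\<^sub>R (?Y - ?X)"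
      using c1 by (simp add: L_def scaleR_add_right)
    also have "\<dots> = c *\<^sub>R ?Y - ?X" by (simp add: algebra_simps)
    finally have "c *\<^sub>R ?Y - ?X = (c - 1) *\<^sub>R L (c / (c - 1))" by (rule sym)
    then show ?thesis using c1 by simp
  qed
  ultimately have "c / (c - 1) \<in> {t0..t1}" unfolding T[symmetric] using closure_subset by auto
  then have "c \<le> t1 * (c - 1)" using c1 by (simp add: pos_divide_le_eq)
  then have b1: "t1 \<le> c * (t1 - 1)" by (simp add: algebra_simps)
  have "(1 / (\<beta> - c)) *\<^sub>R (\<beta> *\<^sub>R ?X - c *\<^sub>R ?Y) \<in> B"
    using normalize_C[of "\<beta> *\<^sub>R ?X - c *\<^sub>R ?Y"] up up' aX by (simp add: inner_diff_right)
  moreover have "(1 / (\<beta> - c)) *\<^sub>R (\<beta> *\<^sub>R ?X - c *\<^sub>R ?Y) = L (- c / (\<beta> - c))"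
  proof -
    have "(\<beta> - c) * (- c / (\<beta> - c)) = - c" using bc by simp
    then have "(\<beta> - c) *\<^sub>R L (- c / (\<beta> - c)) = (\<beta> - c) *\<^sub>R ?X + (- c) *\<^sub>R (?Y - ?X)"
      unfolding L_def scaleR_add_right scaleR_scaleR by presburger
    also have "\<dots> = \<beta> *\<^sub>R ?X - c *\<^sub>R ?Y"
      by (simp add: scaleR_diff_left scaleR_diff_right)
    finally have "\<beta> *\<^sub>R ?X - c *\<^sub>R ?Y = (\<beta> - c) *\<^sub>R L (- c / (\<beta> - c))" by (rule sym)
    then show ?thesis using bc by simp
  qed
  ultimately have "L (- c / (\<beta> - c)) \<in> closure B" using closure_subset by auto
  then have "t0 \<le> - c / (\<beta> - c)" using T by (metis (mono_tags) atLeastAtMost_iff mem_Collect_eq)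
  moreover have "0 < \<beta> - c" using bc by simp
  ultimately have "t0 * (\<beta> - c) \<le> - c" by (simp only: pos_le_divide_eq)
  then have b2: "c * (1 - t0) \<le> \<beta> * (- t0)" by (simp add: algebra_simps)
  have pos: "0 < (- t0) * (t1 - 1)" using t by (intro mult_pos_pos) auto
  have "((1 - t0) * t1) \<le> (1 - t0) * (c * (t1 - 1))" using b1 t by (intro mult_left_mono) auto
  also have "\<dots> = (c * (1 - t0)) * (t1 - 1)" by simp
  also have "\<dots> \<le> (\<beta> * (- t0)) * (t1 - 1)" using b2 t by (intro mult_right_mono) auto
  finally have "((1 - t0) * t1) / ((- t0) * (t1 - 1)) \<le> \<beta>"
    using pos by (simp only: pos_divide_le_eq mult.assoc)
  moreover have "0 < ((1 - t0) * t1) / ((- t0) * (t1 - 1))"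
    using t by (intro divide_pos_pos pos mult_pos_pos) auto
  ultimately show ?thesis unfolding eq by simp
qed

section \<open>Linear lifts of automorphisms\<close>

text \<open>The converse direction is injectivity of the projective action: if the images of two
  vectors under an invertible matrix are proportional, so are the vectors.\<close>

lemma Aut_linear:
  assumes "invertible A" "proj_action A ` \<Omega> = \<Omega>" "v \<noteq> 0"
  shows "proj_pt (A *v v) \<in> \<Omega> \<longleftrightarrow> proj_pt v \<in> \<Omega>"
proof
  assume "proj_pt v \<in> \<Omega>"
  then have "proj_action A (proj_pt v) \<in> proj_action A ` \<Omega>" by (rule imageI)
  then show "proj_pt (A *v v) \<in> \<Omega>" unfolding assms(2) proj_action_proj_pt[OF assms(1,3)] .
next
  assume "proj_pt (A *v v) \<in> \<Omega>"
  then have "proj_pt (A *v v) \<in> proj_action A ` \<Omega>" unfolding assms(2) .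
  then obtain q where q: "q \<in> \<Omega>" "proj_action A q = proj_pt (A *v v)" by (metis imageE)
  obtain u where u: "u \<noteq> 0" "q = proj_pt u" using proj_pt_surj by metis
  have nz: "A *v u \<noteq> 0" "A *v v \<noteq> 0"
    using u(1) assms(3) invertible_mult_eq_0[OF assms(1)] by simp_all
  have "proj_pt (A *v u) = proj_pt (A *v v)" using q(2) u proj_action_proj_pt[OF assms(1) u(1)] by simp
  then have "span {A *v u} = span {A *v v}" using line_of_proj_pt nz by metis
  then have "A *v u \<in> span {A *v v}" using span_base[of "A *v u" "{A *v u}"] by simp
  then obtain t where "A *v u = t *\<^sub>R (A *v v)" by (auto simp: span_singleton)
  then have "A *v (u - t *\<^sub>R v) = 0" by (simp add: matrix_vector_mult_diff_distrib matrix_vector_mult_scaleR)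
  then have "u = t *\<^sub>R v" using invertible_mult_eq_0[OF assms(1)] by simp
  then show "proj_pt v \<in> \<Omega>" using q(1) u proj_pt_scale[OF assms(3), of t] by auto
qed

text \<open>A linear lift of an automorphism preserves \<open>C\<close> up to sign, since \<open>C\<close> is connected.\<close>

lemma Aut_lift:
  assumes A: "invertible A" "proj_action A ` \<Omega> = \<Omega>"
    and inv: "\<And>v. A *v (A' *v v) = v"
  obtains \<sigma> where "\<sigma> = 1 \<or> \<sigma> = (-1 :: real)" "(\<lambda>v. \<sigma> *\<^sub>R (A *v v)) ` C \<subseteq> C"
    "(\<lambda>v. \<sigma> *\<^sub>R (A' *v v)) ` C \<subseteq> C"
proof -
  have C0: "v \<noteq> 0" if "v \<in> C" for v using that by (auto simp: C_def)
  have nz: "a \<bullet> v \<noteq> 0" if "proj_pt v \<in> \<Omega>" "v \<noteq> 0" for v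
    using that closure_subset[of \<Omega>] closure_sub_chart proj_pt_in_chart by blast
  have A\<Omega>: "proj_pt (A *v v) \<in> \<Omega>" "A *v v \<noteq> 0" if "v \<in> C" for v
    using that C0 Aut_linear[OF A] invertible_mult_eq_0[OF A(1)] by (auto simp: C_def)
  have A'\<Omega>: "proj_pt (A' *v v) \<in> \<Omega>" "A' *v v \<noteq> 0" if "v \<in> C" for v
  proof -
    show "A' *v v \<noteq> 0" using C0[OF that] inv[of v] by auto
    then show "proj_pt (A' *v v) \<in> \<Omega>" using Aut_linear[OF A, of "A' *v v"] inv[of v] that by (simp add: C_def)
  qed
  let ?h = "\<lambda>v. a \<bullet> (A *v v)"
  have "convex C"
  proof (rule convexI)
    fix x y :: "real^'n" and u v :: real
    assume xy: "x \<in> C" "y \<in> C" and uv: "0 \<le> u" "0 \<le> v" "u + v = 1"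
    show "u *\<^sub>R x + v *\<^sub>R y \<in> C"
    proof (cases "u = 0 \<or> v = 0")
      case True
      then show ?thesis using xy uv by auto
    next
      case False
      then show ?thesis using xy uv by (intro add_C scale_C) auto
    qed
  qed
  moreover have "continuous_on C ?h"
    by (intro continuous_intros linear_continuous_on matrix_vector_mul_bounded_linear)
  ultimately have conn: "connected (?h ` C)"
    using connected_continuous_image convex_connected by blast
  \<comment> \<open>A change of sign would produce a zero of \<open>?h\<close>, that is, a point of
    \<Omega> on the hyperplane at infinity of the chart.\<close>
  have "(\<forall>v\<in>C. 0 < ?h v) \<or> (\<forall>v\<in>C. ?h v < 0)"
  proof (rule ccontr)
    assume "\<not> ?thesis"
    then obtain v w where vw: "v \<in> C" "w \<in> C" "?h v \<le> 0" "0 \<le> ?h w"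
      by (auto simp: not_less)
    then have "0 \<in> ?h ` C" using connectedD_interval[OF conn, of "?h v" "?h w" 0] by simp
    then obtain u where "u \<in> C" "?h u = 0" by auto
    then show False using nz[OF A\<Omega>] by blast
  qed
  then obtain \<sigma> :: real where \<sigma>: "\<sigma> = 1 \<or> \<sigma> = -1" "\<And>v. v \<in> C \<Longrightarrow> 0 < \<sigma> * ?h v"
  proof
    assume "\<forall>v\<in>C. 0 < ?h v" then show ?thesis using that[of 1] by simp
  next
    assume "\<forall>v\<in>C. ?h v < 0" then show ?thesis using that[of "-1"] by simp
  qed
  have \<sigma>C: "\<sigma> *\<^sub>R v \<in> C" if "proj_pt v \<in> \<Omega>" "v \<noteq> 0" "0 < \<sigma> * (a \<bullet> v)" for v
    using that \<sigma>(1) proj_pt_scale[of v \<sigma>] by (auto simp: C_def)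
  have 1: "(\<lambda>v. \<sigma> *\<^sub>R (A *v v)) ` C \<subseteq> C" using \<sigma>(2) \<sigma>C A\<Omega> by blast
  \<comment> \<open>The inverse must carry the same sign: otherwise the lift of \<open>A\<close>
    would map a vector of \<open>C\<close> to \<open>- v\<close>.\<close>
  have "\<sigma> *\<^sub>R (A' *v v) \<in> C" if v: "v \<in> C" for v
  proof (rule ccontr)
    assume neg: "\<sigma> *\<^sub>R (A' *v v) \<notin> C"
    have "\<not> 0 < \<sigma> * (a \<bullet> (A' *v v))" using neg \<sigma>C A'\<Omega>[OF v] by blast
    moreover have "a \<bullet> (A' *v v) \<noteq> 0" using nz A'\<Omega>[OF v] by blast
    ultimately have "0 < (- \<sigma>) * (a \<bullet> (A' *v v))"
      using \<sigma>(1) by auto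
    then have "(- \<sigma>) *\<^sub>R (A' *v v) \<in> C"
      using \<sigma>(1) A'\<Omega>[OF v] proj_pt_scale[of "A' *v v" "- \<sigma>"] by (auto simp: C_def)
    then have "\<sigma> *\<^sub>R (A *v ((- \<sigma>) *\<^sub>R (A' *v v))) \<in> C" using 1 by blast
    then have "- v \<in> C" using \<sigma>(1) by (auto simp: matrix_vector_mult_scaleR inv scaleR_minus_left[symmetric] simp del: scaleR_minus_left)
    then show False using v by (auto simp: C_def)
  qed
  then show ?thesis using that \<sigma>(1) 1 by blast
qed

text \<open>Quasi-homogeneity moves the ray of \<open>x\<close> onto the ray of a point of
  \<open>K\<close>. Dividing by the value of \<open>a\<close> then lands exactly on the affine
  coordinate of that point, so the coordinate image of \<open>K\<close> serves as the compact set of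
  vectors.\<close>

lemma cocompact_cone_C:
  assumes "quasi_homogeneous \<Omega>" shows "\<exists>K. cocompact_cone C a K"
proof -
  obtain K where K: "K \<subseteq> \<Omega>" "compact K" "(\<Union>g\<in>Aut \<Omega>. g ` K) = \<Omega>"
    using assms by (auto simp: quasi_homogeneous_def)
  have K_cl: "K \<subseteq> closure \<Omega>" using K(1) closure_subset by blast
  have "\<exists>f g. linear f \<and> linear g \<and> (\<forall>v. f (g v) = v) \<and> f ` C \<subseteq> C \<and> g ` C \<subseteq> C \<and> g x \<in> coord \<Omega> ` K"
    if x: "x \<in> C" for x
  proof -
    have x0: "x \<noteq> 0" using x by (auto simp: C_def)
    have "proj_pt x \<in> (\<Union>g\<in>Aut \<Omega>. g ` K)" unfolding K(3) using x by (simp add: C_def)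
    then obtain A k where A: "invertible A" "proj_action A ` \<Omega> = \<Omega>" and k: "k \<in> K" "proj_pt x = proj_action A k"
      by (auto simp: Aut_def PGL_def)
    obtain A' where "A ** A' = mat 1" "A' ** A = mat 1" using A(1) by (auto simp: invertible_def)
    then have inv: "A *v (A' *v v) = v" "A' *v (A *v v) = v" for v
      by (simp_all add: matrix_vector_mul_assoc)
    obtain \<sigma> where \<sigma>: "\<sigma> = 1 \<or> \<sigma> = (-1 :: real)" and AC: "(\<lambda>v. \<sigma> *\<^sub>R (A *v v)) ` C \<subseteq> C"
      and A'C: "(\<lambda>v. \<sigma> *\<^sub>R (A' *v v)) ` C \<subseteq> C"
      using Aut_lift[OF A inv(1)] by blast
    define u where "u = \<sigma> *\<^sub>R (A' *v x)"
    have u: "u \<in> C" using A'C x by (auto simp: u_def)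
    then have au: "0 < a \<bullet> u" by (simp add: C_def)
    have "proj_pt u = k"
    proof -
      have kc: "coord \<Omega> k \<noteq> 0" "proj_pt (coord \<Omega> k) = k"
        using coord_closure[of k] k(1) K_cl by force+
      then have "proj_pt x = proj_pt (A *v coord \<Omega> k)"
        using k(2) proj_action_proj_pt[OF A(1)] by metis
      moreover have "A *v coord \<Omega> k \<noteq> 0" using kc(1) invertible_mult_eq_0[OF A(1)] by blast
      ultimately have "x \<in> span {A *v coord \<Omega> k}"
        using x0 line_of_proj_pt by (metis insertI1 span_base)
      then obtain t where t: "x = t *\<^sub>R (A *v coord \<Omega> k)" by (auto simp: span_singleton)
      then have "u = (\<sigma> * t) *\<^sub>R coord \<Omega> k" by (simp add: u_def matrix_vector_mult_scaleR inv)
      moreover have "\<sigma> * t \<noteq> 0" using t x0 \<sigma> by auto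
      ultimately show ?thesis using proj_pt_scale[OF kc(1), of "\<sigma> * t"] kc(2) by simp
    qed
    then have uK: "(1 / (a \<bullet> u)) *\<^sub>R u \<in> coord \<Omega> ` K" using coord_proj_pt[of u] au k(1) by force
    \<comment> \<open>The positive factors normalize the image of \<open>x\<close> and are inverse
      to each other; the sign cancels in the composition because its square is 1.\<close>
    let ?f = "\<lambda>v. (a \<bullet> u) *\<^sub>R \<sigma> *\<^sub>R (A *v v)"
    let ?g = "\<lambda>v. (1 / (a \<bullet> u)) *\<^sub>R \<sigma> *\<^sub>R (A' *v v)"
    have "linear ?f" "linear ?g"
      by (intro linear_compose_scale_right matrix_vector_mul_linear)+
    moreover have "?f (?g v) = v" for v
      using au \<sigma> by (auto simp: matrix_vector_mult_scaleR inv)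
    moreover have "?f ` C \<subseteq> C"
      by (rule image_subsetI, rule scale_C) (use AC au in auto)
    moreover have "?g ` C \<subseteq> C"
      by (rule image_subsetI, rule scale_C) (use A'C au in auto)
    ultimately show ?thesis using uK unfolding u_def by blast
  qed
  moreover have "compact (coord \<Omega> ` K)"
    unfolding coord_eq using K_cl closure_sub_chart
    by (intro compact_continuous_image continuous_on_subset[OF continuous_on_affine_coord] K(2)) auto
  moreover have "coord \<Omega> ` K \<subseteq> C" using K(1) coord_in_B by (auto simp: B_def)
  ultimately have "cocompact_cone C a (coord \<Omega> ` K)"
    using open_C add_C scale_C bounded_B by unfold_locales (auto simp: C_def B_def)
  then show ?thesis ..
qed

section \<open>Properly embedded simplices from cones\<close>

lemma embedded_simplex_cone_PES:
  assumes "cocompact_cone C a K" and w: "cocompact_cone.embedded_simplex_cone C a m w" and m: "1 \<le> m"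
  shows "PES \<Omega> m (\<lambda>l. proj_pt (w l))"
proof -
  interpret cc: cocompact_cone C a K by fact
  have B': "cc.B = B" by (simp add: cc.B_def B_def)
  obtain x where x: "x \<in> cone_span {..m} w" "x \<in> C" using w by (auto simp: cc.embedded_simplex_cone_def)
  have w_cl: "w l \<in> closure B" if "l \<le> m" for l using w that by (simp add: cc.embedded_simplex_cone_def B')
  have aw: "a \<bullet> w l = 1" "w l \<noteq> 0" if "l \<le> m" for l
    using closure_B_inner[OF w_cl[OF that]] by auto
  have facet_C: "y \<notin> C" if "j \<le> m" "y \<in> cone_span ({..m} - {j}) w" for j y
    using w that by (auto simp: cc.embedded_simplex_cone_def)
  have cl: "proj_pt (w l) \<in> closure \<Omega>" and coord_w: "coord \<Omega> (proj_pt (w l)) = w l" if "l \<le> m" for l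
    using proj_pt_in_closure[OF w_cl[OF that]] coord_proj_pt[of "w l"] aw[OF that] by auto
  have image: "coord \<Omega> ` (\<lambda>l. proj_pt (w l)) ` I = w ` I" if "I \<subseteq> {..m}" for I
    using coord_w that by (force simp: image_image intro!: image_cong)
  have CH_iff: "p \<in> CH \<Omega> ((\<lambda>l. proj_pt (w l)) ` I) \<longleftrightarrow> p \<in> closure \<Omega> \<and> coord \<Omega> p \<in> convex hull (w ` I)"
    if "I \<subseteq> {..m}" for I p
    using mem_CH[of "(\<lambda>l. proj_pt (w l)) ` I" p] image[OF that] cl that by auto
  have "nondegenerate m (\<lambda>l. proj_pt (w l))"
  proof -
    \<comment> \<open>Independence is a statement about the set of vertices, so coincidences in the
      family must be excluded before counting \<open>m + 1\<close> vectors.\<close>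
    have inj: "inj_on w {..m}"
    proof (rule inj_onI)
      fix k l assume kl: "k \<in> {..m}" "l \<in> {..m}" "w k = w l"
      show "k = l"
      proof (rule ccontr)
        assume "k \<noteq> l"
        let ?d = "\<lambda>i. (if i = k then 1 else 0) - (if i = l then 1 else 0 :: real)"
        have "(\<Sum>i\<le>m. ?d i *\<^sub>R w i) = (\<Sum>i\<le>m. (if i = k then w i else 0) - (if i = l then w i else 0))"
          by (intro sum.cong) auto
        also have "\<dots> = 0" using kl by (simp add: sum_subtractf)
        finally have "(\<Sum>i\<le>m. ?d i *\<^sub>R w i) = 0" .
        from cc.embedded_simplex_cone_independent[OF w this, of k] show False
          using kl(1) \<open>k \<noteq> l\<close> by simp
      qed
    qed
    have "independent (w ` {..m})"
      unfolding independent_explicit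
      using cc.embedded_simplex_cone_independent[OF w] by (auto simp: sum.reindex[OF inj])
    then have "dim (span (w ` {..m})) = m + 1"
      using dim_span_eq_card_independent[of "w ` {..m}"] card_image[OF inj] by simp
    moreover have "span (\<Union>l\<le>m. line_of (proj_pt (w l))) = span (w ` {..m})"
    proof
      have "(\<Union>l\<le>m. line_of (proj_pt (w l))) \<subseteq> span (w ` {..m})"
      proof (rule UN_least)
        fix l assume "l \<in> {..m}"
        then show "line_of (proj_pt (w l)) \<subseteq> span (w ` {..m})"
          using aw(2)[of l] span_mono[of "{w l}" "w ` {..m}"] by (simp add: line_of_proj_pt)
      qed
      then show "span (\<Union>l\<le>m. line_of (proj_pt (w l))) \<subseteq> span (w ` {..m})"
        by (simp add: span_minimal subspace_span)
      show "span (w ` {..m}) \<subseteq> span (\<Union>l\<le>m. line_of (proj_pt (w l)))"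
        using aw(2) by (intro span_mono) (auto simp: line_of_proj_pt intro: span_base)
    qed
    ultimately show ?thesis by (simp add: nondegenerate_def)
  qed
  moreover have "proj_pt (w l) \<in> bdry \<Omega>" if l: "l \<le> m" for l
  proof -
    \<comment> \<open>As \<open>m \<ge> 1\<close>, there is a second index \<open>j\<close>. Vertex
      \<open>l\<close> lies on the facet opposite \<open>j\<close>, which misses
      \<open>C\<close>.\<close>
    obtain j where j: "j \<le> m" "j \<noteq> l"
      by (rule that[of "if l = 0 then 1 else 0"]) (use m in auto)
    then have "w l \<notin> C" using facet_C[OF j(1) cone_span_generator[of "{..m} - {j}" l w]] l by auto
    then show ?thesis using cl[OF l] aw[OF l] by (simp add: bdry_def C_def)
  qed
  moreover have "proj_simplex \<Omega> m (\<lambda>l. proj_pt (w l)) \<inter> \<Omega> \<noteq> {}"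
  proof -
    have ax: "0 < a \<bullet> x" using x(2) by (simp add: C_def)
    have "proj_pt x \<in> \<Omega>" using x(2) by (simp add: C_def)
    moreover have "coord \<Omega> (proj_pt x) \<in> convex hull (w ` {..m})"
      using convex_hull_cone_span[OF _ _ x(1) ax] aw(1) coord_proj_pt[of x] ax by simp
    ultimately have "proj_pt x \<in> proj_simplex \<Omega> m (\<lambda>l. proj_pt (w l))"
      unfolding proj_simplex_def using CH_iff[of "{..m}"] closure_subset[of \<Omega>] by blast
    then show ?thesis using \<open>proj_pt x \<in> \<Omega>\<close> by blast
  qed
  moreover have "facet \<Omega> m (\<lambda>l. proj_pt (w l)) j \<subseteq> bdry \<Omega>" if j: "j \<le> m" for j
  proof
    fix p assume "p \<in> facet \<Omega> m (\<lambda>l. proj_pt (w l)) j"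
    then have p: "p \<in> closure \<Omega>" "coord \<Omega> p \<in> convex hull (w ` ({..m} - {j}))"
      unfolding facet_def using CH_iff[of "{..m} - {j}"] by auto
    then have "coord \<Omega> p \<notin> C" using facet_C[OF j] cone_span_convex_hull[OF _ p(2)] by auto
    then have "p \<notin> \<Omega>" using coord_in_B by (auto simp: B_def)
    then show "p \<in> bdry \<Omega>" using p(1) by (simp add: bdry_def)
  qed
  ultimately show ?thesis using m by (simp add: PES_def)
qed

text \<open>A supremum of natural numbers bounds its set only if the set is bounded; here
  non-degeneracy bounds the dimension by that of the ambient space.\<close>

lemma PES_le_r_PES: assumes "PES \<Omega> k v" shows "k \<le> r_PES \<Omega>"
proof -
  have "k \<le> CARD('n)" if "PES \<Omega> k v" for k v
  proof -
    have "k + 1 \<le> DIM(real^'n)"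
      using that dim_subset_UNIV[of "span (\<Union>i\<le>k. line_of (v i))"] by (simp add: PES_def nondegenerate_def)
    then show ?thesis by simp
  qed
  then have "bdd_above {k. \<exists>v. PES \<Omega> k v}" by (intro bdd_aboveI[of _ "CARD('n)"]) auto
  then show ?thesis unfolding r_PES_def using assms by (intro cSup_upper) auto
qed

section \<open>Slimness of compact simplices\<close>

text \<open>By convexity a facet of a compact simplex stays in \<Omega>, so the distances to it are
  bounded below by 0 and one close point controls the infimum. The same bound makes \<delta>
  positive, which selects the metric branch of \<open>hilbert_nbhd\<close>.\<close>

lemma facet_in_nbhd:
  assumes v: "\<And>l. l \<le> m \<Longrightarrow> v l \<in> \<Omega>" and p: "p \<in> \<Omega>" and q: "q \<in> facet \<Omega> m v j"
    and d: "hilbert_dist \<Omega> p q < \<delta>"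
  shows "p \<in> hilbert_nbhd \<Omega> \<delta> (facet \<Omega> m v j)"
proof -
  have facet_sub: "facet \<Omega> m v j \<subseteq> \<Omega>"
  proof
    fix c assume c: "c \<in> facet \<Omega> m v j"
    have "v ` ({..m} - {j}) \<subseteq> closure \<Omega>" using v closure_subset[of \<Omega>] by auto
    then have c: "c \<in> closure \<Omega>" "coord \<Omega> c \<in> convex hull (coord \<Omega> ` v ` ({..m} - {j}))"
      using c mem_CH by (auto simp: facet_def)
    have "convex hull (coord \<Omega> ` v ` ({..m} - {j})) \<subseteq> B"
      using v coord_in_B by (intro hull_minimal convex_B) auto
    then have "proj_pt (coord \<Omega> c) \<in> \<Omega>" using c(2) by (auto simp: B_def C_def)
    then show "c \<in> \<Omega>" using coord_closure(3)[OF c(1)] by simp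
  qed
  have bdd: "bdd_below (hilbert_dist \<Omega> p ` facet \<Omega> m v j)"
    using hilbert_dist_nonneg[OF p] facet_sub by (intro bdd_belowI2[of _ 0]) auto
  have "(INF c\<in>facet \<Omega> m v j. hilbert_dist \<Omega> p c) < \<delta>"
    using cINF_lower[OF bdd q] d by linarith
  moreover have "0 < \<delta>" using d hilbert_dist_nonneg[OF p] q facet_sub by fastforce
  ultimately show ?thesis using p by (simp add: hilbert_nbhd_def)
qed

text \<open>A facet has \<open>m\<close> vertices, at least one more than Caratheodory's theorem
  uses. So each of its points already lies on a second facet, at distance 0.\<close>

lemma slim_large:
  assumes v: "\<And>l. l \<le> m \<Longrightarrow> v l \<in> \<Omega>" and m: "CARD('n) + 2 \<le> m" and "0 < \<delta>"
  shows "slim \<Omega> \<delta> m v"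
  unfolding slim_def
proof (intro allI impI subsetI)
  fix i p assume i: "i \<le> m" and p: "p \<in> facet \<Omega> m v i"
  have sub: "v ` ({..m} - J) \<subseteq> closure \<Omega>" for J using v closure_subset[of \<Omega>] by auto
  have p: "p \<in> closure \<Omega>" "coord \<Omega> p \<in> convex hull ((\<lambda>l. coord \<Omega> (v l)) ` ({..m} - {i}))"
    using p mem_CH[OF sub] by (auto simp: facet_def image_image)
  have "card ({..m} - {i}) = m" using i by simp
  then have "card ({..m} - {i}) > DIM(real^'n) + 1" using m by simp
  then obtain j where j: "j \<in> {..m} - {i}"
    "coord \<Omega> p \<in> convex hull ((\<lambda>l. coord \<Omega> (v l)) ` ({..m} - {i} - {j}))"
    using convex_hull_drop_vertex[OF _ _ p(2)] by blast
  have "coord \<Omega> p \<in> convex hull ((\<lambda>l. coord \<Omega> (v l)) ` ({..m} - {j}))"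
    using j(2) hull_mono[of "(\<lambda>l. coord \<Omega> (v l)) ` ({..m} - {i} - {j})"
      "(\<lambda>l. coord \<Omega> (v l)) ` ({..m} - {j})" convex] by blast
  then have q: "p \<in> facet \<Omega> m v j" using p(1) mem_CH[OF sub] by (simp add: facet_def image_image)
  have "convex hull ((\<lambda>l. coord \<Omega> (v l)) ` ({..m} - {i})) \<subseteq> B"
    using v coord_in_B by (intro hull_minimal convex_B) auto
  then have "proj_pt (coord \<Omega> p) \<in> \<Omega>" using p(2) by (auto simp: B_def C_def)
  then have "p \<in> \<Omega>" using coord_closure(3)[OF p(1)] by simp
  then have "p \<in> hilbert_nbhd \<Omega> \<delta> (facet \<Omega> m v j)"
    using facet_in_nbhd[OF v _ q] \<open>0 < \<delta>\<close> by (simp add: hilbert_dist_def)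
  then show "p \<in> (\<Union>j\<in>{..m} - {i}. hilbert_nbhd \<Omega> \<delta> (facet \<Omega> m v j))" using j(1) by blast
qed

text \<open>The constant depends on \<Omega> and \<open>m\<close> but not on the simplex. The
  inequality for \<delta> is strict because neighbourhoods are open while the distance estimate is
  not strict.\<close>

lemma slim_no_PES:
  assumes "quasi_homogeneous \<Omega>" and "\<nexists>v. PES \<Omega> m v" and m: "1 \<le> m"
  shows "\<exists>\<beta>\<ge>1. \<forall>v \<delta>. (\<forall>l\<le>m. v l \<in> \<Omega>) \<longrightarrow> 1 / 2 * ln \<beta> < \<delta> \<longrightarrow> slim \<Omega> \<delta> m v"
proof -
  obtain K where K: "cocompact_cone C a K" using cocompact_cone_C assms(1) by blast
  interpret cc: cocompact_cone C a K by fact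
  have "\<nexists>w. cc.embedded_simplex_cone m w"
    using embedded_simplex_cone_PES[OF K _ m] assms(2) by blast
  then obtain \<beta> where \<beta>: "1 \<le> \<beta>" and near: "\<And>w i x. i \<le> m \<Longrightarrow> \<forall>l\<le>m. w l \<in> C \<Longrightarrow>
    x \<in> cone_span ({..m} - {i}) w \<Longrightarrow> x \<in> C \<Longrightarrow>
    \<exists>j\<in>{..m} - {i}. \<exists>y\<in>cone_span ({..m} - {j}) w. cc.le x y \<and> cc.le y (\<beta> *\<^sub>R x)"
    using cc.near_other_facet by meson
  have "slim \<Omega> \<delta> m v" if v: "\<forall>l\<le>m. v l \<in> \<Omega>" and \<delta>: "1 / 2 * ln \<beta> < \<delta>" for v \<delta>
    unfolding slim_def
  proof (intro allI impI subsetI)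
    fix i p assume i: "i \<le> m" and p: "p \<in> facet \<Omega> m v i"
    let ?w = "\<lambda>l. coord \<Omega> (v l)"
    have sub: "v ` ({..m} - J) \<subseteq> closure \<Omega>" for J using v closure_subset[of \<Omega>] by auto
    have mem_facet: "q \<in> facet \<Omega> m v j \<longleftrightarrow> q \<in> closure \<Omega> \<and> coord \<Omega> q \<in> convex hull (?w ` ({..m} - {j}))"
      for q j using mem_CH[OF sub] by (simp add: facet_def image_image)
    have w: "?w l \<in> B" if "l \<le> m" for l using coord_in_B v that by blast
    then have wC: "\<forall>l\<le>m. ?w l \<in> C" "\<And>l. l \<le> m \<Longrightarrow> a \<bullet> ?w l = 1"
      by (auto simp: B_def)
    have p_cl: "p \<in> closure \<Omega>" and hull: "coord \<Omega> p \<in> convex hull (?w ` ({..m} - {i}))"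
      using p mem_facet by auto
    have "convex hull (?w ` ({..m} - {i})) \<subseteq> B"
      using w by (intro hull_minimal convex_B) auto
    then have pC: "coord \<Omega> p \<in> C"
      using hull by (auto simp: B_def)
    then have p\<Omega>: "p \<in> \<Omega>" using coord_closure(3)[OF p_cl] by (simp add: C_def)
    obtain j y where j: "j \<in> {..m} - {i}" and y: "y \<in> cone_span ({..m} - {j}) ?w"
      "cc.le (coord \<Omega> p) y" "cc.le y (\<beta> *\<^sub>R coord \<Omega> p)"
      using near[OF i wC(1) cone_span_convex_hull[OF _ hull] pC] by blast
    have yC: "y \<in> C" using cc.in_C_le[OF pC y(2)] .
    then have ay: "0 < a \<bullet> y" and q\<Omega>: "proj_pt y \<in> \<Omega>" by (auto simp: C_def)
    have coord_q: "coord \<Omega> (proj_pt y) = (1 / (a \<bullet> y)) *\<^sub>R y" using coord_proj_pt ay by simp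
    have "proj_pt y \<in> facet \<Omega> m v j"
      unfolding mem_facet coord_q
      using convex_hull_cone_span[OF _ _ y(1) ay] wC(2) q\<Omega> closure_subset[of \<Omega>] by auto
    \<comment> \<open>The comparison vector \<open>y\<close> is \<open>a \<bullet> y\<close> times
      the affine coordinate of its point; this is the scaling factor \<open>c\<close> of
      \<open>hilbert_dist_le\<close>.\<close>
    moreover have "hilbert_dist \<Omega> p (proj_pt y) \<le> 1 / 2 * ln \<beta>"
      using hilbert_dist_le[OF p\<Omega> q\<Omega> ay \<beta>] y(2,3) ay by (simp add: coord_q cc.le_def)
    ultimately have "p \<in> hilbert_nbhd \<Omega> \<delta> (facet \<Omega> m v j)"
      using facet_in_nbhd[OF _ p\<Omega>] v \<delta> by simp
    then show "p \<in> (\<Union>j\<in>{..m} - {i}. hilbert_nbhd \<Omega> \<delta> (facet \<Omega> m v j))" using j by blast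
  qed
  then show ?thesis using \<beta> by blast
qed

end

theorem theorem1p3:
  fixes \<Omega> :: "('n::finite) proj set"
  assumes "properly_convex_domain \<Omega>"
    and "quasi_homogeneous \<Omega>"
  shows "\<exists>\<delta>\<^sub>0>0. \<forall>m v. m \<ge> r_PES \<Omega> + 1 \<longrightarrow> compact_simplex \<Omega> m v \<longrightarrow> slim \<Omega> \<delta>\<^sub>0 m v"
proof -
  interpret convex_projective_domain \<Omega> using assms(1) by unfold_locales
  have "\<nexists>v. PES \<Omega> m v" if "r_PES \<Omega> + 1 \<le> m" for m
    using PES_le_r_PES[of m] that by fastforce
  then have "\<exists>\<beta>\<ge>1. \<forall>v \<delta>. (\<forall>l\<le>m. v l \<in> \<Omega>) \<longrightarrow> 1 / 2 * ln \<beta> < \<delta> \<longrightarrow> slim \<Omega> \<delta> m v"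
    if "r_PES \<Omega> + 1 \<le> m" for m
    using slim_no_PES[OF assms(2)] that by simp
  then obtain \<beta> where \<beta>: "\<And>m. r_PES \<Omega> + 1 \<le> m \<Longrightarrow> 1 \<le> \<beta> m"
    "\<And>m v \<delta>. r_PES \<Omega> + 1 \<le> m \<Longrightarrow> \<forall>l\<le>m. v l \<in> \<Omega> \<Longrightarrow> 1 / 2 * ln (\<beta> m) < \<delta> \<Longrightarrow> slim \<Omega> \<delta> m v"
    by metis
  \<comment> \<open>For \<open>m\<close> at most \<open>r_PES \<Omega>\<close> the value
    \<open>\<beta> m\<close> is arbitrary, but it can only enlarge the maximum. Inserting 1 makes
    \<open>ln b\<close> nonnegative.\<close>
  define b where "b = Max (insert 1 (\<beta> ` {..CARD('n) + 2}))"
  have b1: "1 \<le> b" unfolding b_def by (intro Max_ge) auto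
  \<comment> \<open>Adding 1 gives the strict inequality required for slimness, and positivity even
    if \<open>b = 1\<close>.\<close>
  define \<delta> where "\<delta> = 1 / 2 * ln b + 1"
  have "0 < \<delta>" using b1 by (simp add: \<delta>_def add_nonneg_pos)
  moreover have "slim \<Omega> \<delta> m v" if m: "r_PES \<Omega> + 1 \<le> m" and v: "compact_simplex \<Omega> m v" for m v
  proof (cases "CARD('n) + 2 \<le> m")
    case True
    then show ?thesis using slim_large[OF _ True \<open>0 < \<delta>\<close>] v by (simp add: compact_simplex_def)
  next
    case False
    then have "\<beta> m \<le> b" unfolding b_def by (intro Max_ge) auto
    then have "ln (\<beta> m) \<le> ln b" using \<beta>(1)[OF m] b1 by simp
    then show ?thesis using \<beta>(2)[OF m] v by (simp add: compact_simplex_def \<delta>_def)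
  qed
  ultimately show ?thesis by blast
qed

end
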